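(* Let $r \ge 2$, $k \ge 1$ and $n \ge 1$ be integers and let $\mathbf{s} = (s_1, \dots, s_n)$ be a vector of positive integers with $s_i \in [b(r)-1]$. Then $\chi(\mathrm{KG}^r_{\mathbf{s}}(n,k)) \ge \left\lceil \frac{(\sum_i s_i)-r(k-1)}{r-1} \right\rceil$. In particular, for an integer $s$ with $s-1\in[b(r)-1]$, $\chi(\mathrm{KG}^r_{s-1}(n,k)) \ge \left\lceil \frac{(s-1)n-r(k-1)}{r-1} \right\rceil$.
   Context: For an integer $r\ge2$ with prime factorization $r=2^{\alpha_0}p_1^{\alpha_1}\cdots p_t^{\alpha_t}$ ($p_i$ pairwise distinct odd primes, $\alpha_i\ge0$), $b(r)=2^{\alpha_0}(p_1-1)^{\alpha_1}\cdots(p_t-1)^{\alpha_t}$. For a hypergraph $H$ (a set of hyperedges, each a multisubset of the vertex set), an $m$-coloring is a map from the vertices to $[m]$ such that no hyperedge is monochromatic; $\chi(H)$ is the least such $m$. $\mathrm{KG}^r_{\mathbf{s}}(n,k)$ is the hypergraph on vertex set $\binom{[n]}{k}$ (the $k$-element subsets of $[n]$) in which a multisubset $\{\{A_1,\dots,A_r\}\}$ is a hyperedge iff each $i\in[n]$ is contained in at most $s_i$ of the sets $A_1,\dots,A_r$ (counted with multiplicity). $\mathrm{KG}^r_{s-1}(n,k)$ denotes $\mathrm{KG}^r_{(s-1,\dots,s-1)}(n,k)$, i.e., $\{\{A_1,\dots,A_r\}\}$ is a hyperedge iff $A_{i_1}\cap\dots\cap A_{i_s}=\emptyset$ for all pairwise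 distinct $i_1,\dots,i_s\in[r]$. *)

theory Defs
  imports Complex_Main "HOL-Library.Multiset" "HOL-Library.FuncSet"
    "HOL-Computational_Algebra.Primes"
begin

definition b_fun :: "nat \<Rightarrow> nat" where
  "b_fun r = (\<Prod>p\<in>prime_factors r. (if p = 2 then 2 else p - 1) ^ multiplicity p r)"

text \<open>A hypergraph is a pair of a vertex set and a set of hyperedges; hyperedges are
  multisets of vertices. Since repeated vertices are allowed, a hyperedge supported on a single
  vertex is monochromatic under every map.\<close>

type_synonym 'a hypergraph = "'a set \<times> 'a multiset set"

definition monochromatic :: "('a \<Rightarrow> nat) \<Rightarrow> 'a multiset \<Rightarrow> bool" where
  "monochromatic c e \<longleftrightarrow> (\<exists>j. \<forall>v\<in>#e. c v = j)"

definition is_coloring :: "'a hypergraph \<Rightarrow> nat \<Rightarrow> ('a \<Rightarrow> nat) \<Rightarrow> bool" where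
  "is_coloring H m c \<longleftrightarrow> c \<in> fst H \<rightarrow> {1..m} \<and> (\<forall>e\<in>snd H. \<not> monochromatic c e)"

text \<open>The value is unspecified if \<open>H\<close> has no coloring at all; the lemma
  \<open>KG_colorable\<close> below shows that this does not happen for the hypergraphs of interest.\<close>

definition chromatic_number :: "'a hypergraph \<Rightarrow> nat" where
  "chromatic_number H = (LEAST m. \<exists>c. is_coloring H m c)"

text \<open>The vector \<open>(s\<^sub>1, \<dots>, s\<^sub>n)\<close> is a function on \<^typ>\<open>nat\<close>
  of which only the values on \<open>{1..n}\<close> matter.\<close>

definition KG :: "nat \<Rightarrow> (nat \<Rightarrow> nat) \<Rightarrow> nat \<Rightarrow> nat \<Rightarrow> nat set hypergraph" where
  "KG r s n k =
    (let V = {A. A \<subseteq> {1..n} \<and> card A = k}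
     in (V, {M. set_mset M \<subseteq> V \<and> size M = r \<and>
                (\<forall>i\<in>{1..n}. size {#A \<in># M. i \<in> A#} \<le> s i)}))"

lemma KG_colorable:
  assumes "k \<ge> 1" and "r \<ge> 1" and s: "\<forall>i\<in>{1..n}. s i < r"
  shows "\<exists>m c. is_coloring (KG r s n k) m c"
proof -
  define V where "V = {A. A \<subseteq> {1..n} \<and> card A = k}"
  have "finite V" by (rule finite_subset[of _ "Pow {1..n}"]) (auto simp: V_def)
  then obtain f where "bij_betw f {1..card V} V" using ex_bij_betw_nat_finite_1 by blast
  then obtain c where c: "bij_betw c V {1..card V}" using bij_betw_inv by blast
  have "\<not> monochromatic c M" if M: "M \<in> snd (KG r s n k)" for M
  proof
    assume "monochromatic c M"
    then obtain j where j: "\<forall>v\<in>#M. c v = j" unfolding monochromatic_def by blast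
    have MV: "set_mset M \<subseteq> V" and sz: "size M = r"
      and deg: "\<forall>i\<in>{1..n}. size {#A \<in># M. i \<in> A#} \<le> s i"
      using M by (auto simp: KG_def V_def Let_def)
    have "M \<noteq> {#}" using sz \<open>r \<ge> 1\<close> by auto
    then obtain A where A: "A \<in># M" by blast
    have eq: "B = A" if "B \<in># M" for B
      using bij_betw_imp_inj_on[OF c] j MV A that by (metis inj_onD subsetD)
    have "A \<subseteq> {1..n}" "card A = k" using A MV by (auto simp: V_def)
    moreover from this have "A \<noteq> {}" using \<open>k \<ge> 1\<close> by auto
    ultimately obtain i where i: "i \<in> A" "i \<in> {1..n}" by blast
    have "{#B \<in># M. i \<in> B#} = M" using eq i by (auto simp: filter_mset_eq_conv)
    then have "r \<le> s i" using deg i sz by force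
    then show False using s i by force
  qed
  moreover have "c \<in> fst (KG r s n k) \<rightarrow> {1..card V}"
    using bij_betw_imp_funcset[OF c] by (simp add: KG_def V_def Let_def)
  ultimately show ?thesis unfolding is_coloring_def by blast
qed

lemma KG_const_hyperedge_iff:
  assumes "s \<ge> 1"
  shows "mset As \<in> snd (KG r (\<lambda>_. s - 1) n k) \<longleftrightarrow>
    (\<forall>A\<in>set As. A \<subseteq> {1..n} \<and> card A = k) \<and> length As = r \<and>
    (\<forall>I. I \<subseteq> {..<r} \<and> card I = s \<longrightarrow> (\<Inter>j\<in>I. As ! j) = {})"
proof -
  have cnt: "size {#A \<in># mset As. i \<in> A#} = card {j. j < length As \<and> i \<in> As ! j}" for i
    by (metis length_filter_conv_card mset_filter size_mset)
  have "(\<forall>i\<in>{1..n}. card {j. j < r \<and> i \<in> As ! j} \<le> s - 1) \<longleftrightarrow>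
        (\<forall>I. I \<subseteq> {..<r} \<and> card I = s \<longrightarrow> (\<Inter>j\<in>I. As ! j) = {})"
    if V: "\<forall>A\<in>set As. A \<subseteq> {1..n} \<and> card A = k" and len: "length As = r"
  proof
    assume L: "\<forall>i\<in>{1..n}. card {j. j < r \<and> i \<in> As ! j} \<le> s - 1"
    show "\<forall>I. I \<subseteq> {..<r} \<and> card I = s \<longrightarrow> (\<Inter>j\<in>I. As ! j) = {}"
    proof (intro allI impI, rule ccontr)
      fix I assume I: "I \<subseteq> {..<r} \<and> card I = s" and "(\<Inter>j\<in>I. As ! j) \<noteq> {}"
      then obtain i where i: "\<forall>j\<in>I. i \<in> As ! j" by blast
      have "I \<noteq> {}" using I \<open>s \<ge> 1\<close> by auto
      then obtain j where j: "j \<in> I" by blast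
      then have "As ! j \<in> set As" using I len by auto
      then have "i \<in> {1..n}" using V i j by blast
      moreover have "card I \<le> card {j. j < r \<and> i \<in> As ! j}"
        using I i by (intro card_mono) auto
      ultimately show False using L I \<open>s \<ge> 1\<close> by force
    qed
  next
    assume R: "\<forall>I. I \<subseteq> {..<r} \<and> card I = s \<longrightarrow> (\<Inter>j\<in>I. As ! j) = {}"
    show "\<forall>i\<in>{1..n}. card {j. j < r \<and> i \<in> As ! j} \<le> s - 1"
    proof (rule ballI, rule ccontr)
      fix i assume "\<not> card {j. j < r \<and> i \<in> As ! j} \<le> s - 1"
      then have "s \<le> card {j. j < r \<and> i \<in> As ! j}" by simp
      then obtain I where I: "I \<subseteq> {j. j < r \<and> i \<in> As ! j}" "card I = s"
        by (meson obtain_subset_with_card_n)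
      then have "i \<in> (\<Inter>j\<in>I. As ! j)" "I \<subseteq> {..<r}" by auto
      then show False using R I by blast
    qed
  qed
  then show ?thesis by (auto simp: KG_def Let_def cnt)
qed

end

theory Submission
  imports Defs "HOL-Library.Poly_Mapping" "HOL-Library.Nat_Bijection" "HOL-Number_Theory.Cong"
begin

text \<open>
  Suppose the \<open>k\<close>-subsets of \<open>[n]\<close> are colored with \<open>m\<close> colors and no hyperedge is monochromatic;
  the claim is \<open>\<Sum>s\<^sub>i \<le> r(k - 1) + (r - 1)m\<close>, and it turns out to hold as soon as all \<open>s\<^sub>i \<le> r\<close>.

  Let \<open>r = p\<close> be prime and \<open>s\<^sub>i < p\<close>. Sets \<open>A \<subseteq> [n] \<times> \<int>\<^sub>p\<close> with at most \<open>s\<^sub>i\<close> points over each \<open>i\<close>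
  form the join of the \<open>(s\<^sub>i - 1)\<close>-skeleta of simplices, a complex of dimension \<open>\<Sum>s\<^sub>i - 1\<close> which is
  acyclic below its dimension and on which \<open>\<int>\<^sub>p\<close> acts freely. If all layers of \<open>A\<close> have fewer than
  \<open>k\<close> points, \<open>A\<close> gets the level \<open>|A| \<le> p(k - 1)\<close>. Otherwise let \<open>S\<^sub>j\<close> be the set of residues whose
  layer contains a \<open>k\<close>-set of color \<open>j\<close>; it is a proper subset of \<open>\<int>\<^sub>p\<close>, and \<open>A\<close> gets the level
  \<open>p(k - 1) + \<Sum>|S\<^sub>j| \<le> p(k - 1) + (p - 1)m\<close>. Together with an equivariant sign in \<open>\<int>\<^sub>p\<close> this is a map
  from the barycentric subdivision to a join of copies of \<open>\<int>\<^sub>p\<close>, one for each level, so by the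
  theorem of Borsuk--Ulam type for \<open>\<int>\<^sub>p\<close> there are at least \<open>\<Sum>s\<^sub>i\<close> levels. That theorem is proved by
  mapping the periodic resolution of \<open>\<int>\<^sub>p\<close> into the chains of the complex and evaluating on it the
  pullback of the generator of the cohomology of \<open>\<int>\<^sub>p\<close>, which vanishes on degenerate simplices.

  The bound for \<open>s\<^sub>i \<le> p\<close> reduces to \<open>s\<^sub>i < p\<close>, and the bounds for \<open>r\<close> and \<open>r'\<close> imply that for \<open>rr'\<close>.
\<close>

section \<open>Ordered chains\<close>

text \<open>Chains are spanned by lists of vertices, repetitions allowed; the empty list has degree
  \<open>-1\<close>, so the complex is augmented. Using lists instead of oriented simplices makes all maps
  natural without any choice of signs.\<close>

definition cone :: "'a \<Rightarrow> ('a list \<Rightarrow>\<^sub>0 int) \<Rightarrow> ('a list \<Rightarrow>\<^sub>0 int)" where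
  "cone v = frag_extend (\<lambda>L. frag_of (v # L))"

primrec list_boundary :: "'a list \<Rightarrow> ('a list \<Rightarrow>\<^sub>0 int)" where
  "list_boundary [] = 0"
| "list_boundary (x # xs) = frag_of xs - cone x (list_boundary xs)"

definition boundary :: "('a list \<Rightarrow>\<^sub>0 int) \<Rightarrow> ('a list \<Rightarrow>\<^sub>0 int)" where
  "boundary = frag_extend list_boundary"

definition push :: "('a \<Rightarrow> 'b) \<Rightarrow> ('a list \<Rightarrow>\<^sub>0 int) \<Rightarrow> ('b list \<Rightarrow>\<^sub>0 int)" where
  "push f = frag_extend (\<lambda>L. frag_of (map f L))"

definition ordered_chains :: "'a set set \<Rightarrow> nat \<Rightarrow> ('a list \<Rightarrow>\<^sub>0 int) set" where
  "ordered_chains K l = {z. Poly_Mapping.keys z \<subseteq> {L. length L = l \<and> set L \<in> K}}"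

lemma cone_simps [simp]:
  "cone v 0 = 0" "cone v (frag_of L) = frag_of (v # L)"
  "cone v (a + b) = cone v a + cone v b" "cone v (a - b) = cone v a - cone v b"
  by (simp_all add: cone_def frag_extend_add frag_extend_diff)

lemma boundary_simps [simp]:
  "boundary 0 = 0" "boundary (frag_of L) = list_boundary L"
  "boundary (a + b) = boundary a + boundary b" "boundary (a - b) = boundary a - boundary b"
  by (simp_all add: boundary_def frag_extend_add frag_extend_diff)

lemma push_simps [simp]:
  "push f 0 = 0" "push f (frag_of L) = frag_of (map f L)"
  "push f (a + b) = push f a + push f b" "push f (a - b) = push f a - push f b"
  by (simp_all add: push_def frag_extend_add frag_extend_diff)

lemma boundary_sum: "finite I \<Longrightarrow> boundary (\<Sum>i\<in>I. z i) = (\<Sum>i\<in>I. boundary (z i))"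
  by (simp add: boundary_def frag_extend_sum)

lemma push_sum: "finite I \<Longrightarrow> push f (\<Sum>i\<in>I. z i) = (\<Sum>i\<in>I. push f (z i))"
  by (simp add: push_def frag_extend_sum)

text \<open>\<open>cone v\<close> is a contracting homotopy; because of the augmentation the
  identity has no exception in the lowest degree.\<close>

lemma boundary_cone: "boundary (cone v z) = z - cone v (boundary z)"
  using subset_UNIV by (induction z rule: frag_induction) (auto simp: algebra_simps)

lemma boundary_list_boundary: "boundary (list_boundary L) = 0"
  by (induction L) (auto simp: boundary_cone)

lemma boundary_boundary [simp]: "boundary (boundary z) = 0"
  using subset_UNIV by (induction z rule: frag_induction) (auto simp: boundary_list_boundary)

lemma push_cone: "push f (cone v z) = cone (f v) (push f z)"
  using subset_UNIV by (induction z rule: frag_induction) auto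

lemma list_boundary_map: "list_boundary (map f L) = push f (list_boundary L)"
  by (induction L) (auto simp: push_cone)

lemma boundary_push: "boundary (push f z) = push f (boundary z)"
  using subset_UNIV by (induction z rule: frag_induction) (auto simp: list_boundary_map)

lemma push_push: "push f (push g z) = push (f \<circ> g) z"
  using subset_UNIV by (induction z rule: frag_induction) (auto simp: comp_def)

lemma push_cong:
  assumes "\<And>L. L \<in> Poly_Mapping.keys z \<Longrightarrow> map f L = map g L"
  shows "push f z = push g z"
  unfolding push_def by (rule frag_extend_eq) (simp only: assms)

lemma keys_cone: "Poly_Mapping.keys (cone v z) \<subseteq> (#) v ` Poly_Mapping.keys z"
  unfolding cone_def by (rule order_trans[OF keys_frag_extend]) auto

lemma keys_push: "Poly_Mapping.keys (push f z) \<subseteq> map f ` Poly_Mapping.keys z"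
  unfolding push_def by (rule order_trans[OF keys_frag_extend]) auto

lemma keys_list_boundary:
  "M \<in> Poly_Mapping.keys (list_boundary L) \<Longrightarrow> length L = Suc (length M) \<and> set M \<subseteq> set L"
proof (induction L arbitrary: M)
  case (Cons x xs)
  then consider "M = xs" | N where "M = x # N" "N \<in> Poly_Mapping.keys (list_boundary xs)"
    using keys_diff[of "frag_of xs" "cone x (list_boundary xs)"] keys_cone[of x "list_boundary xs"]
    by (auto dest!: subsetD)
  then show ?case using Cons.IH by cases auto
qed auto

lemma keys_boundary:
  assumes "M \<in> Poly_Mapping.keys (boundary z)"
  shows "\<exists>L\<in>Poly_Mapping.keys z. length L = Suc (length M) \<and> set M \<subseteq> set L"
proof -
  obtain L where "L \<in> Poly_Mapping.keys z" "M \<in> Poly_Mapping.keys (list_boundary L)"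
    using assms keys_frag_extend[of list_boundary z] unfolding boundary_def by blast
  then show ?thesis using keys_list_boundary by blast
qed

lemma ordered_chains_0 [simp]: "0 \<in> ordered_chains K l"
  by (simp add: ordered_chains_def)

lemma ordered_chains_add: "a \<in> ordered_chains K l \<Longrightarrow> b \<in> ordered_chains K l \<Longrightarrow> a + b \<in> ordered_chains K l"
  unfolding ordered_chains_def using keys_add[of a b] by blast

lemma ordered_chains_diff: "a \<in> ordered_chains K l \<Longrightarrow> b \<in> ordered_chains K l \<Longrightarrow> a - b \<in> ordered_chains K l"
  unfolding ordered_chains_def using keys_diff[of a b] by blast

lemma ordered_chains_sum: "(\<And>i. i \<in> I \<Longrightarrow> z i \<in> ordered_chains K l) \<Longrightarrow> (\<Sum>i\<in>I. z i) \<in> ordered_chains K l"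
  by (induction I rule: infinite_finite_induct) (auto intro: ordered_chains_add)

lemma ordered_chains_mono: "z \<in> ordered_chains K l \<Longrightarrow> K \<subseteq> K' \<Longrightarrow> z \<in> ordered_chains K' l"
  unfolding ordered_chains_def by blast

lemma ordered_chains_push:
  assumes "z \<in> ordered_chains K l" "\<And>A. A \<in> K \<Longrightarrow> f ` A \<in> K'"
  shows "push f z \<in> ordered_chains K' l"
  using assms keys_push[of f z] unfolding ordered_chains_def by fastforce

lemma ordered_chains_cone:
  assumes "z \<in> ordered_chains K l" "\<And>A. A \<in> K \<Longrightarrow> insert v A \<in> K'"
  shows "cone v z \<in> ordered_chains K' (Suc l)"
  using assms keys_cone[of v z] unfolding ordered_chains_def by fastforce

section \<open>Acyclicity of joins of skeleta\<close>

definition acyclic_upto :: "nat \<Rightarrow> 'a set set \<Rightarrow> bool" where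
  "acyclic_upto d K \<longleftrightarrow>
    (\<forall>l<d. \<forall>z\<in>ordered_chains K l. boundary z = 0 \<longrightarrow> (\<exists>w\<in>ordered_chains K (Suc l). boundary w = z))"

lemma acyclic_upto_cone:
  assumes "\<And>A. A \<in> K \<Longrightarrow> insert v A \<in> K"
  shows "acyclic_upto d K"
  unfolding acyclic_upto_def
proof (intro allI impI ballI)
  fix l z assume "z \<in> ordered_chains K l" "boundary z = 0"
  then show "\<exists>w\<in>ordered_chains K (Suc l). boundary w = z"
    using assms by (intro bexI[of _ "cone v z"]) (auto simp: boundary_cone intro: ordered_chains_cone)
qed

text \<open>Mayer--Vietoris for the cover of \<open>K\<close> by the star and the deletion of \<open>v\<close>,
  which meet in the link of \<open>v\<close>.\<close>

lemma acyclic_upto_link_deletion: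
  assumes down: "\<And>A B. A \<in> K \<Longrightarrow> B \<subseteq> A \<Longrightarrow> B \<in> K"
    and del: "acyclic_upto (Suc d) {A \<in> K. v \<notin> A}"
    and link: "acyclic_upto d {A. v \<notin> A \<and> insert v A \<in> K}"
  shows "acyclic_upto (Suc d) K"
  unfolding acyclic_upto_def
proof (intro allI impI ballI)
  fix l z assume l: "l < Suc d" and z: "z \<in> ordered_chains K l" and bz: "boundary z = 0"
  let ?del = "{A \<in> K. v \<notin> A}" and ?link = "{A. v \<notin> A \<and> insert v A \<in> K}"
  let ?star = "{A. insert v A \<in> K}"
  have link_star: "?link \<subseteq> ?star" and link_del: "?link \<subseteq> ?del"
    using down by blast+
  \<comment> \<open>\<open>a\<close> collects the lists through \<open>v\<close>, \<open>b\<close>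
    those avoiding it. Their boundaries are opposite, so that of \<open>a\<close> lies in both star
    and deletion, that is, in the link.\<close>
  have "Poly_Mapping.keys z \<subseteq> {L. length L = l \<and> set L \<in> K \<and> v \<in> set L}
      \<union> {L. length L = l \<and> set L \<in> ?del}"
    using z unfolding ordered_chains_def by blast
  then obtain a b where a: "Poly_Mapping.keys a \<subseteq> {L. length L = l \<and> set L \<in> K \<and> v \<in> set L}"
    and b: "b \<in> ordered_chains ?del l" and ab: "a + b = z"
    unfolding ordered_chains_def by (rule frag_split) blast
  have aS: "a \<in> ordered_chains ?star l" using a unfolding ordered_chains_def by (auto simp: insert_absorb)
  have eq: "boundary a = 0 - boundary b" using bz ab by (metis boundary_simps(3) add_eq_0_iff2 diff_0)
  have "\<exists>w\<in>ordered_chains ?link l. boundary w = boundary a"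
  proof (cases l)
    case 0
    then have "L \<notin> Poly_Mapping.keys a" for L using a by fastforce
    then have "a = 0" using keys_eq_empty by blast
    then show ?thesis by (intro bexI[of _ 0]) auto
  next
    case (Suc l')
    have "boundary a \<in> ordered_chains ?link l'"
      unfolding ordered_chains_def
    proof (rule CollectI, rule subsetI)
      fix M assume M: "M \<in> Poly_Mapping.keys (boundary a)"
      then obtain L where "L \<in> Poly_Mapping.keys a" "length L = Suc (length M)" "set M \<subseteq> set L"
        using keys_boundary by blast
      then have 1: "length M = l'" "insert v (set M) \<in> K"
        using a Suc down[of "set L" "insert v (set M)"] by auto
      have "M \<in> Poly_Mapping.keys (boundary b)" using M eq by (simp add: keys_minus)
      then obtain L where "L \<in> Poly_Mapping.keys b" "set M \<subseteq> set L"
        using keys_boundary by blast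
      then have "v \<notin> set M" using b unfolding ordered_chains_def by auto
      then show "M \<in> {L. length L = l' \<and> set L \<in> ?link}" using 1 by auto
    qed
    moreover have "l' < d" using l Suc by simp
    ultimately show ?thesis using link Suc unfolding acyclic_upto_def by auto
  qed
  then obtain w where w: "w \<in> ordered_chains ?link l" "boundary w = boundary a" by blast
  \<comment> \<open>Through \<open>w\<close> the cycle splits into \<open>a - w\<close>, a cycle in
    the star filled by a cone, and \<open>b + w\<close>, a cycle in the deletion.\<close>
  have "boundary (b + w) = 0" using w eq by simp
  moreover have "b + w \<in> ordered_chains ?del l"
    using b ordered_chains_mono[OF w(1) link_del] by (rule ordered_chains_add)
  ultimately obtain w' where w': "w' \<in> ordered_chains ?del (Suc l)" "boundary w' = b + w"
    using del l unfolding acyclic_upto_def by blast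
  have c: "cone v (a - w) \<in> ordered_chains K (Suc l)"
    by (rule ordered_chains_cone[OF ordered_chains_diff[OF aS ordered_chains_mono[OF w(1) link_star]]]) auto
  have "w' \<in> ordered_chains K (Suc l)" using w'(1) by (rule ordered_chains_mono) auto
  with c have "cone v (a - w) + w' \<in> ordered_chains K (Suc l)" by (rule ordered_chains_add)
  moreover have "boundary (cone v (a - w) + w') = z"
    using w w' ab by (simp add: boundary_cone algebra_simps del: cone_simps(4))
  ultimately show "\<exists>w\<in>ordered_chains K (Suc l). boundary w = z" by blast
qed

text \<open>The independence complex of a direct sum of uniform matroids.\<close>

definition capped :: "('i \<times> 'a) set \<Rightarrow> ('i \<Rightarrow> nat) \<Rightarrow> ('i \<times> 'a) set set" where
  "capped E s = {A. A \<subseteq> E \<and> (\<forall>i. card {v \<in> A. fst v = i} \<le> s i)}"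

lemma capped_mono:
  assumes "finite E" "A \<in> capped E s" "B \<subseteq> A"
  shows "B \<in> capped E s"
proof -
  have "card {v \<in> B. fst v = i} \<le> card {v \<in> A. fst v = i}" for i
  proof (rule card_mono)
    show "finite {v \<in> A. fst v = i}" using assms by (auto simp: capped_def intro: finite_subset)
  qed (use assms in auto)
  then show ?thesis using assms unfolding capped_def by (fastforce intro: le_trans)
qed

text \<open>Induction on the ground set. If the cap at \<open>i\<close> does not restrict the points
  over \<open>i\<close>, each of them is a cone point. Otherwise deleting \<open>v\<close> preserves
  the sum and passing to its link lowers it by one, as the Mayer--Vietoris step requires.\<close>

lemma acyclic_upto_capped:
  assumes "finite E" "finite J" "d \<le> (\<Sum>i\<in>J. min (s i) (card {v \<in> E. fst v = i}))"
  shows "acyclic_upto d (capped E s)"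
  using assms
proof (induction "card E" arbitrary: E s d rule: less_induct)
  case less
  show ?case
  proof (cases d)
    case 0
    then show ?thesis by (simp add: acyclic_upto_def)
  next
    case (Suc d')
    have "(\<Sum>i\<in>J. min (s i) (card {v \<in> E. fst v = i})) > 0" using Suc less.prems by linarith
    then obtain i where i: "i \<in> J" "s i > 0" "card {v \<in> E. fst v = i} > 0"
      by (metis (no_types, lifting) bot_nat_0.not_eq_extremum less_numeral_extra(3) min_0L min_0R sum.neutral)
    then obtain v where v: "v \<in> E" "fst v = i" by (metis (mono_tags, lifting) Collect_empty_eq card.empty less_irrefl)
    have fin: "finite {v \<in> E. P v}" for P using less.prems by simp
    show ?thesis
    proof (cases "card {v \<in> E. fst v = i} \<le> s i")
      case True
      show ?thesis
      proof (rule acyclic_upto_cone[of _ v])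
        fix A assume A: "A \<in> capped E s"
        have "card {u \<in> insert v A. fst u = j} \<le> s j" for j
        proof (cases "j = i")
          case True
          have "card {u \<in> insert v A. fst u = j} \<le> card {v \<in> E. fst v = i}"
            using A v True fin unfolding capped_def by (intro card_mono) auto
          then show ?thesis using True \<open>card {v \<in> E. fst v = i} \<le> s i\<close> by simp
        next
          case False
          then have "{u \<in> insert v A. fst u = j} = {u \<in> A. fst u = j}" using v by auto
          then show ?thesis using A unfolding capped_def by auto
        qed
        then show "insert v A \<in> capped E s" using A v unfolding capped_def by auto
      qed
    next
      case False
      let ?E = "E - {v}" and ?s = "s(i := s i - 1)"
      have smaller: "card ?E < card E" using v less.prems by (meson card_Diff1_less)
      have ci: "card {u \<in> ?E. fst u = i} = card {u \<in> E. fst u = i} - 1"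
      proof -
        have "{u \<in> ?E. fst u = i} = {u \<in> E. fst u = i} - {v}" by auto
        then show ?thesis using v fin by (simp add: card_Diff_singleton)
      qed
      have cj: "{u \<in> ?E. fst u = j} = {u \<in> E. fst u = j}" if "j \<in> J - {i}" for j using v that by auto
      let ?f = "\<lambda>i. min (s i) (card {v \<in> E. fst v = i})"
      have sumJ: "sum f J = f i + sum f (J - {i})" for f :: "'a \<Rightarrow> nat"
        using i less.prems by (simp add: sum.remove)
      have r1: "(\<Sum>j\<in>J. min (s j) (card {u \<in> ?E. fst u = j})) = sum ?f J"
        unfolding sumJ ci using False by (simp add: cj cong: sum.cong del: Diff_iff)
      have r2: "Suc (\<Sum>j\<in>J. min (?s j) (card {u \<in> ?E. fst u = j})) = sum ?f J"
        unfolding sumJ ci using False i cj by (auto intro!: sum.cong)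
      have del: "{A \<in> capped E s. v \<notin> A} = capped ?E s" unfolding capped_def by auto
      have "A \<in> capped ?E ?s \<longleftrightarrow> v \<notin> A \<and> insert v A \<in> capped E s" for A
      proof (cases "v \<notin> A \<and> A \<subseteq> E")
        case True
        then have "finite A" using less.prems finite_subset by blast
        have "{u \<in> insert v A. fst u = i} = insert v {u \<in> A. fst u = i}" using v by auto
        then have "card {u \<in> insert v A. fst u = i} = Suc (card {u \<in> A. fst u = i})"
          using True \<open>finite A\<close> by simp
        moreover have "{u \<in> insert v A. fst u = j} = {u \<in> A. fst u = j}" if "j \<noteq> i" for j
          using v that by auto
        ultimately have "card {u \<in> A. fst u = j} \<le> ?s j \<longleftrightarrow> card {u \<in> insert v A. fst u = j} \<le> s j" for j
          using i by (cases "j = i") auto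
        then show ?thesis using True v unfolding capped_def by auto
      qed (auto simp: capped_def)
      then have link: "{A. v \<notin> A \<and> insert v A \<in> capped E s} = capped ?E ?s" by blast
      have "acyclic_upto (Suc d') (capped E s)"
      proof (rule acyclic_upto_link_deletion[where v = v])
        show "B \<in> capped E s" if "A \<in> capped E s" "B \<subseteq> A" for A B
          using capped_mono less.prems(1) that by blast
        show "acyclic_upto (Suc d') {A \<in> capped E s. v \<notin> A}"
          unfolding del using less.prems Suc r1 by (intro less.hyps[OF smaller]) auto
        show "acyclic_upto d' {A. v \<notin> A \<and> insert v A \<in> capped E s}"
          unfolding link using less.prems Suc r2 by (intro less.hyps[OF smaller]) auto
      qed
      then show ?thesis using Suc by simp
    qed
  qed
qed

section \<open>Cocycles of the cyclic group\<close>

text \<open>\<open>frag_extend\<close> lands in free abelian groups, so the integers enter as the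
  free group on \<open>()\<close>.\<close>

definition pairing :: "('a \<Rightarrow> int) \<Rightarrow> ('a \<Rightarrow>\<^sub>0 int) \<Rightarrow> int" where
  "pairing \<phi> z = Poly_Mapping.lookup (frag_extend (\<lambda>L. frag_cmul (\<phi> L) (frag_of ())) z) ()"

lemma pairing_simps [simp]:
  "pairing \<phi> 0 = 0" "pairing \<phi> (frag_of L) = \<phi> L"
  "pairing \<phi> (a + b) = pairing \<phi> a + pairing \<phi> b" "pairing \<phi> (a - b) = pairing \<phi> a - pairing \<phi> b"
  by (simp_all add: pairing_def frag_extend_add frag_extend_diff lookup_add lookup_minus)

lemma pairing_sum: "finite I \<Longrightarrow> pairing \<phi> (\<Sum>i\<in>I. z i) = (\<Sum>i\<in>I. pairing \<phi> (z i))"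
  by (induction I rule: finite_induct) auto

lemma pairing_cone: "pairing \<phi> (cone v z) = pairing (\<lambda>L. \<phi> (v # L)) z"
  using subset_UNIV by (induction z rule: frag_induction) auto

lemma pairing_push: "pairing \<phi> (push f z) = pairing (\<lambda>L. \<phi> (map f L)) z"
  using subset_UNIV by (induction z rule: frag_induction) auto

lemma pairing_boundary: "pairing \<phi> (boundary z) = pairing (\<lambda>L. pairing \<phi> (list_boundary L)) z"
  using subset_UNIV by (induction z rule: frag_induction) auto

lemma pairing_mult: "pairing (\<lambda>L. c * \<phi> L) z = c * pairing \<phi> z"
  using subset_UNIV by (induction z rule: frag_induction) (auto simp: algebra_simps)

lemma pairing_fun_diff: "pairing (\<lambda>L. \<phi> L - \<psi> L) z = pairing \<phi> z - pairing \<psi> z"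
  using subset_UNIV by (induction z rule: frag_induction) auto

lemma pairing_fun_sum: "pairing (\<lambda>L. \<Sum>i\<in>I. \<phi> i L) z = (\<Sum>i\<in>I. pairing (\<phi> i) z)"
  using subset_UNIV by (induction z rule: frag_induction) (auto simp: sum_subtractf)

lemma pairing_cong_mod:
  assumes "Poly_Mapping.keys z \<subseteq> S" "\<And>L. L \<in> S \<Longrightarrow> [\<phi> L = \<psi> L] (mod p)"
  shows "[pairing \<phi> z = pairing \<psi> z] (mod p)"
  using assms(1)
  by (induction z rule: frag_induction) (auto simp: assms(2) intro: cong_diff)

lemma pairing_cong:
  assumes "Poly_Mapping.keys z \<subseteq> S" "\<And>L. L \<in> S \<Longrightarrow> \<phi> L = \<psi> L"
  shows "pairing \<phi> z = pairing \<psi> z"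
  using assms(1) by (induction z rule: frag_induction) (auto simp: assms(2))

text \<open>For residues \<open>a, b, c\<close> in \<open>{0..<p}\<close>, \<open>carry a b c\<close> is the carry that occurs when
  \<open>b - a\<close> and \<open>c - b\<close> are added modulo \<open>p\<close>. It represents the generator of the second cohomology
  of the cyclic group of order \<open>p\<close>; its cup powers, and their products with the class
  \<open>b - a\<close> of degree one, give the generators in all degrees.\<close>

definition descent :: "int \<Rightarrow> int \<Rightarrow> int" where
  "descent a b = (if b < a then 1 else 0)"

definition carry :: "int \<Rightarrow> int \<Rightarrow> int \<Rightarrow> int" where
  "carry a b c = descent b c - descent a c + descent a b"

text \<open>In odd length this is the cup power of \<open>carry\<close>: consecutive triples share
  an endpoint. In positive even length the last entry is ignored.\<close>

fun even_cocycle :: "int list \<Rightarrow> int" where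
  "even_cocycle (a # b # c # R) = carry a b c * even_cocycle (c # R)"
| "even_cocycle _ = 1"

fun cyclic_cocycle :: "int \<Rightarrow> int list \<Rightarrow> int" where
  "cyclic_cocycle p [] = 1"
| "cyclic_cocycle p (a # L) =
    (if even (length L) then even_cocycle (a # L) else (hd L - a) mod p * even_cocycle L)"

definition rot :: "int \<Rightarrow> nat \<Rightarrow> int \<Rightarrow> int" where
  "rot p t a = (a + int t) mod p"

text \<open>Induction splits off the first triple. The faces omitting an entry of \<open>R\<close>
  are summed by the hypothesis; the rest is the cocycle identity for \<open>carry\<close>, the
  coboundary of \<open>descent\<close>.\<close>

lemma even_cocycle_boundary:
  "L \<noteq> [] \<Longrightarrow> even (length L) \<Longrightarrow> pairing even_cocycle (list_boundary L) = 0"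
proof (induction L rule: even_cocycle.induct)
  case (1 a b c R)
  then obtain d R' where R: "R = d # R'" by (cases R) auto
  let ?x = "pairing (\<lambda>L. even_cocycle (c # L)) (list_boundary R)"
  have x: "?x = even_cocycle R" using 1 by (simp add: pairing_cone)
  have "pairing even_cocycle (list_boundary (a # b # c # R)) =
    even_cocycle (b # c # R) - even_cocycle (a # c # R) + even_cocycle (a # b # R)
      - carry a b c * ?x"
    by (simp add: pairing_cone pairing_mult)
  then show ?case unfolding x by (simp add: R carry_def algebra_simps del: list_boundary.simps)
qed (auto simp: pairing_cone)

text \<open>Modulo \<open>p\<close> the degree-one class is the coboundary of the residue itself,
  which is not invariant under rotation. Times the cup power this makes the cocycle a coboundary, so
  its value on a chain can be read off from the boundary.\<close>

lemma cyclic_cocycle_even_length: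
  assumes "even (length L)" "L \<noteq> []"
  shows "[cyclic_cocycle p L = pairing (\<lambda>L. hd L * even_cocycle L) (list_boundary L)] (mod p)"
proof -
  obtain a b R where L: "L = a # b # R" using assms
    by (cases L; cases "tl L") auto
  let ?x = "pairing (\<lambda>L. even_cocycle (a # b # L)) (list_boundary R)"
  have "even_cocycle (b # R) - even_cocycle (a # R) + ?x = 0"
    using even_cocycle_boundary[OF assms(2,1)] by (simp add: L pairing_cone)
  then have x: "?x = even_cocycle (a # R) - even_cocycle (b # R)" by simp
  have "pairing (\<lambda>L. hd L * even_cocycle L) (list_boundary L) =
      b * even_cocycle (b # R) - a * even_cocycle (a # R) + a * ?x"
    by (simp add: L pairing_cone pairing_mult)
  also have "\<dots> = (b - a) * even_cocycle (b # R)" unfolding x by (simp add: algebra_simps)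
  finally show ?thesis using assms(1)
    by (simp add: L cong_def mod_mult_left_eq)
qed

text \<open>The first factor \<open>carry\<close> is the coboundary of \<open>descent\<close>, and
  the remaining factors form a cocycle.\<close>

lemma cyclic_cocycle_odd_length:
  assumes "odd (length L)" "length L \<ge> 3"
  shows "cyclic_cocycle p L =
    pairing (\<lambda>L. descent (L ! 0) (L ! 1) * even_cocycle (tl L)) (list_boundary L)"
proof -
  obtain a b c R where L: "L = a # b # c # R" using assms(2)
    by (metis Suc_le_length_iff numeral_3_eq_3)
  let ?x = "pairing (\<lambda>L. even_cocycle (b # c # L)) (list_boundary R)"
  have "even_cocycle (c # R) - even_cocycle (b # R) + ?x = 0"
    using even_cocycle_boundary[of "b # c # R"] assms(1) by (simp add: L pairing_cone)
  then have x: "?x = even_cocycle (b # R) - even_cocycle (c # R)" by simp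
  have "pairing (\<lambda>L. descent (L ! 0) (L ! 1) * even_cocycle (tl L)) (list_boundary L) =
      descent b c * even_cocycle (c # R) - descent a c * even_cocycle (c # R)
      + descent a b * even_cocycle (b # R) - descent a b * ?x"
    by (simp add: L pairing_cone pairing_mult)
  also have "\<dots> = cyclic_cocycle p L" unfolding x using assms(1)
    by (simp add: L carry_def algebra_simps)
  finally show ?thesis by simp
qed

section \<open>Behavior under rotations and on degenerate lists\<close>

lemma descent_mod:
  assumes "a \<in> {0..<p}" "b \<in> {0..<p}"
  shows "p * descent a b = (b - a) mod p - (b - a)"
proof (cases "b < a")
  case True
  then have "(b - a + p) mod p = b - a + p" using assms by (intro mod_pos_pos_trivial) auto
  then have "(b - a) mod p = b - a + p" by simp
  then show ?thesis using True by (simp add: descent_def)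
next
  case False
  then show ?thesis using assms by (simp add: descent_def)
qed

lemma rot_range [simp]: "p > 0 \<Longrightarrow> rot p t a \<in> {0..<p}"
  by (simp add: rot_def)

lemma rot_diff_mod: "(rot p t b - rot p t a) mod p = (b - a) mod p"
  by (simp add: rot_def mod_diff_eq)

text \<open>\<open>p * carry\<close> is the coboundary of \<open>(b - a) mod p\<close>, which
  depends on differences alone.\<close>

lemma carry_rot:
  assumes "p > 0" "a \<in> {0..<p}" "b \<in> {0..<p}" "c \<in> {0..<p}"
  shows "carry (rot p t a) (rot p t b) (rot p t c) = carry a b c"
proof -
  have *: "p * carry x y z = (z - y) mod p - (z - x) mod p + (y - x) mod p"
    if "x \<in> {0..<p}" "y \<in> {0..<p}" "z \<in> {0..<p}" for x y z
    using descent_mod[OF that(1,2)] descent_mod[OF that(2,3)] descent_mod[OF that(1,3)]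
    by (simp add: carry_def algebra_simps)
  have "p * carry (rot p t a) (rot p t b) (rot p t c) = p * carry a b c"
    using assms by (simp only: * rot_range rot_diff_mod)
  then show ?thesis using assms by simp
qed

lemma even_cocycle_rot:
  assumes "p > 0"
  shows "set L \<subseteq> {0..<p} \<Longrightarrow> even_cocycle (map (rot p t) L) = even_cocycle L"
proof (induction L rule: even_cocycle.induct)
  case (1 a b c R)
  then show ?case using carry_rot[OF assms, of a b c t] by (simp del: atLeastLessThan_iff)
qed auto

lemma sum_rot:
  assumes "n > 0"
  shows "(\<Sum>t<n. rot (int n) t a) = (\<Sum>t<n. int t)"
proof (rule sum.reindex_bij_witness[of _ "\<lambda>u. nat ((int u - a) mod int n)" "\<lambda>t. nat (rot (int n) t a)"])
  fix t assume t: "t \<in> {..<n}"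
  have "((a + int t) mod int n - a) mod int n = int t"
    using t by (simp add: mod_diff_left_eq)
  then show "nat ((int (nat (rot (int n) t a)) - a) mod int n) = t" using assms by (simp add: rot_def)
  show "nat (rot (int n) t a) \<in> {..<n}" "int (nat (rot (int n) t a)) = rot (int n) t a"
    using assms by (simp_all add: rot_def nat_less_iff)
next
  fix u assume u: "u \<in> {..<n}"
  show "nat ((int u - a) mod int n) \<in> {..<n}" using assms by (simp add: nat_less_iff)
  have "(a + (int u - a) mod int n) mod int n = int u" using u by (simp add: mod_add_right_eq)
  then show "nat (rot (int n) (nat ((int u - a) mod int n)) a) = u" using assms by (simp add: rot_def)
qed

text \<open>In the sum of \<open>descent_mod\<close> over all rotations the linear terms cancel,
  since \<open>a\<close> and \<open>b\<close> both run through all residues. So the norm of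
  \<open>descent\<close> is the degree-one class.\<close>

lemma sum_descent_rot:
  assumes "n > 0"
  shows "(\<Sum>t<n. descent (rot (int n) t a) (rot (int n) t b)) = (b - a) mod int n"
proof -
  have "int n * (\<Sum>t<n. descent (rot (int n) t a) (rot (int n) t b)) =
      (\<Sum>t<n. (b - a) mod int n - (rot (int n) t b - rot (int n) t a))"
    unfolding sum_distrib_left using assms
    by (intro sum.cong) (simp_all only: descent_mod rot_range of_nat_0_less_iff rot_diff_mod)
  also have "\<dots> = int n * ((b - a) mod int n)"
    using sum_rot[OF assms, of a] sum_rot[OF assms, of b] by (simp add: sum_subtractf)
  finally show ?thesis using assms by simp
qed

text \<open>\<open>carry\<close> vanishes when neighbouring arguments agree, and in odd length every
  pair of neighbours lies in one of the triples.\<close>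

lemma even_cocycle_adjacent:
  "odd (length (xs @ a # a # ys)) \<Longrightarrow> even_cocycle (xs @ a # a # ys) = 0"
proof (induction xs rule: even_cocycle.induct)
  case (1 x y z R)
  then show ?case by auto
next
  case "2_1"
  then show ?case by (cases ys) (auto simp: carry_def descent_def)
next
  case ("2_2" x)
  then show ?case by (auto simp: carry_def descent_def)
next
  case ("2_3" x y)
  then show ?case by (cases ys) (auto simp: carry_def descent_def)
qed

lemma cyclic_cocycle_adjacent: "cyclic_cocycle p (xs @ a # a # ys) = 0"
proof (cases "odd (length (xs @ a # a # ys))")
  case True
  then show ?thesis using even_cocycle_adjacent[of xs a ys] by (cases xs) auto
next
  case False
  then show ?thesis
    using even_cocycle_adjacent[of "tl xs" a ys] by (cases xs) auto
qed

text \<open>The differentials \<open>g - 1\<close> and \<open>1 + g + \<dots> + g ^ (n - 1)\<close> of the periodic resolution of the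
  cyclic group, with \<open>l\<close> the length of the lists, i.e. one more than the degree.\<close>

definition resolution_step :: "nat \<Rightarrow> (nat \<Rightarrow> 'a \<Rightarrow> 'a) \<Rightarrow> nat \<Rightarrow> ('a list \<Rightarrow>\<^sub>0 int) \<Rightarrow> ('a list \<Rightarrow>\<^sub>0 int)" where
  "resolution_step n g l z =
    (if l = 0 then z else if odd l then push (g 1) z - z else (\<Sum>t<n. push (g t) z))"

text \<open>Induction on the degree: the cocycle is the coboundary of a cochain
  \<open>?\<eta>\<close>, so evaluation passes to the boundary, and the differential of the
  resolution turns \<open>?\<eta>\<close> into the cocycle one degree lower.\<close>

lemma pairing_cyclic_cocycle:
  fixes W :: "nat \<Rightarrow> (int list \<Rightarrow>\<^sub>0 int)"
  assumes n: "n > 0" and W0: "W 0 = frag_of []"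
    and bd: "\<And>l. l < N \<Longrightarrow> boundary (W (Suc l)) = resolution_step n (rot (int n)) l (W l)"
    and keys: "\<And>l. l \<le> N \<Longrightarrow> Poly_Mapping.keys (W l) \<subseteq> {L. length L = l \<and> set L \<subseteq> {0..<int n}}"
  shows "l < N \<Longrightarrow> [pairing (cyclic_cocycle (int n)) (W (Suc l)) = 1] (mod int n)"
proof (induction l)
  case 0
  \<comment> \<open>On one-element lists the cocycle is \<open>1\<close>, so it computes the
    augmentation.\<close>
  have "pairing (cyclic_cocycle (int n)) (W (Suc 0)) = pairing (\<lambda>L. pairing (\<lambda>_. 1) (list_boundary L)) (W (Suc 0))"
    by (rule pairing_cong[OF keys]) (use 0 in \<open>auto simp: length_Suc_conv\<close>)
  also have "\<dots> = pairing (\<lambda>_. 1) (boundary (W (Suc 0)))" by (simp add: pairing_boundary)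
  also have "\<dots> = 1" using bd 0 by (simp add: resolution_step_def W0)
  finally show ?case by simp
next
  case (Suc l)
  let ?c = "cyclic_cocycle (int n)" and ?l = "Suc l"
  have l: "?l < N" using Suc.prems by simp
  have bd': "boundary (W (Suc ?l)) = resolution_step n (rot (int n)) ?l (W ?l)" using bd l by simp
  have "[pairing ?c (W (Suc ?l)) = pairing ?c (W ?l)] (mod int n)"
  proof (cases "even l")
    case True
    let ?\<eta> = "\<lambda>L. hd L * even_cocycle L"
    have "[pairing ?c (W (Suc ?l)) = pairing (\<lambda>L. pairing ?\<eta> (list_boundary L)) (W (Suc ?l))] (mod int n)"
      by (rule pairing_cong_mod[OF keys cyclic_cocycle_even_length]) (use l True in auto)
    also have "pairing (\<lambda>L. pairing ?\<eta> (list_boundary L)) (W (Suc ?l)) =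
        pairing (\<lambda>L. ?\<eta> (map (rot (int n) 1) L) - ?\<eta> L) (W ?l)"
      unfolding pairing_boundary[symmetric] bd' using True
      by (simp add: resolution_step_def pairing_push pairing_fun_diff)
    also have "[\<dots> = pairing ?c (W ?l)] (mod int n)"
    proof (rule pairing_cong_mod[OF keys])
      show "?l \<le> N" using l by simp
      fix L assume L: "L \<in> {L. length L = ?l \<and> set L \<subseteq> {0..<int n}}"
      then obtain a R where R: "L = a # R" by (cases L) auto
      have e: "even_cocycle (map (rot (int n) 1) L) = even_cocycle L"
        using even_cocycle_rot[of "int n" L 1] n L by auto
      have "?\<eta> (map (rot (int n) 1) L) - ?\<eta> L = ((a + 1) mod int n - a) * even_cocycle L"
        unfolding e by (simp add: R rot_def algebra_simps)
      also have "[\<dots> = 1 * even_cocycle L] (mod int n)"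
        by (intro cong_mult) (auto simp: cong_def mod_diff_left_eq)
      finally show "[?\<eta> (map (rot (int n) 1) L) - ?\<eta> L = ?c L] (mod int n)"
        using L True by (simp add: R)
    qed
    finally show ?thesis .
  next
    case False
    let ?\<eta> = "\<lambda>L. descent (L ! 0) (L ! 1) * even_cocycle (tl L)"
    have "pairing ?c (W (Suc ?l)) = pairing (\<lambda>L. pairing ?\<eta> (list_boundary L)) (W (Suc ?l))"
    proof (rule pairing_cong[OF keys cyclic_cocycle_odd_length])
      fix L assume "L \<in> {L. length L = Suc ?l \<and> set L \<subseteq> {0..<int n}}"
      then show "odd (length L)" "length L \<ge> 3" using False by (cases l; auto)+
    qed (use l in auto)
    also have "\<dots> = pairing (\<lambda>L. \<Sum>t<n. ?\<eta> (map (rot (int n) t) L)) (W ?l)"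
      unfolding pairing_boundary[symmetric] bd' using False
      by (simp add: resolution_step_def pairing_push pairing_fun_sum pairing_sum)
    also have "\<dots> = pairing ?c (W ?l)"
    proof (rule pairing_cong[OF keys])
      show "?l \<le> N" using l by simp
      fix L assume L: "L \<in> {L. length L = ?l \<and> set L \<subseteq> {0..<int n}}"
      then obtain a b R where R: "L = a # b # R" using False
        by (cases L; cases "tl L") auto
      have e: "even_cocycle (map (rot (int n) t) (b # R)) = even_cocycle (b # R)" for t
        using even_cocycle_rot[of "int n" "b # R" t] n L R by auto
      have "(\<Sum>t<n. ?\<eta> (map (rot (int n) t) L)) =
          (\<Sum>t<n. descent (rot (int n) t a) (rot (int n) t b) * even_cocycle (map (rot (int n) t) (b # R)))"
        by (simp add: R)
      also have "\<dots> = (b - a) mod int n * even_cocycle (b # R)"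
        unfolding e by (simp only: sum_distrib_right[symmetric] sum_descent_rot[OF n])
      finally show "(\<Sum>t<n. ?\<eta> (map (rot (int n) t) L)) = ?c L"
        using L False by (simp add: R)
    qed
    finally show ?thesis by simp
  qed
  then show ?case using Suc by (auto intro: cong_trans)
qed

section \<open>Barycentric subdivision\<close>

text \<open>The barycentre of a list is its set of entries, also for degenerate lists. The length is
  a separate argument because the recursion runs over faces.\<close>

primrec list_subdivision :: "nat \<Rightarrow> 'a list \<Rightarrow> ('a set list \<Rightarrow>\<^sub>0 int)" where
  "list_subdivision 0 L = frag_of []"
| "list_subdivision (Suc l) L = cone (set L) (frag_extend (list_subdivision l) (list_boundary L))"

definition subdivision :: "nat \<Rightarrow> ('a list \<Rightarrow>\<^sub>0 int) \<Rightarrow> ('a set list \<Rightarrow>\<^sub>0 int)" where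
  "subdivision l = frag_extend (list_subdivision l)"

lemma subdivision_simps [simp]:
  "subdivision l 0 = 0" "subdivision l (frag_of L) = list_subdivision l L"
  "subdivision l (a + b) = subdivision l a + subdivision l b"
  "subdivision l (a - b) = subdivision l a - subdivision l b"
  by (simp_all add: subdivision_def frag_extend_add frag_extend_diff)

lemma subdivision_sum: "finite I \<Longrightarrow> subdivision l (\<Sum>i\<in>I. z i) = (\<Sum>i\<in>I. subdivision l (z i))"
  by (simp add: subdivision_def frag_extend_sum)

lemma list_subdivision_Suc: "list_subdivision (Suc l) L = cone (set L) (subdivision l (list_boundary L))"
  by (simp add: subdivision_def)

lemma boundary_subdivision_0: "boundary (subdivision 0 z) = 0"
  using subset_UNIV by (induction z rule: frag_induction) auto

lemma boundary_subdivision: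
  assumes "Poly_Mapping.keys z \<subseteq> {L. length L = Suc l}"
  shows "boundary (subdivision (Suc l) z) = subdivision l (boundary z)"
  using assms
proof (induction l arbitrary: z)
  case 0
  then show ?case
    by (induction z rule: frag_induction)
      (auto simp: list_subdivision_Suc boundary_cone boundary_subdivision_0 simp del: list_subdivision.simps(2))
next
  case (Suc l)
  have IH: "boundary (subdivision (Suc l) (list_boundary L)) = 0" if "length L = Suc (Suc l)" for L :: "'a list"
  proof -
    have "Poly_Mapping.keys (list_boundary L) \<subseteq> {L. length L = Suc l}"
      using keys_list_boundary that by fastforce
    then show ?thesis using Suc.IH by (simp add: boundary_list_boundary)
  qed
  show ?case using Suc.prems
    by (induction z rule: frag_induction)
      (auto simp: list_subdivision_Suc[of "Suc l"] boundary_cone IH simp del: list_subdivision.simps(2))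
qed

lemma subdivision_push: "subdivision l (push f z) = push ((`) f) (subdivision l z)"
proof (induction l arbitrary: z)
  case 0
  show ?case using subset_UNIV by (induction z rule: frag_induction) auto
next
  case (Suc l)
  show ?case using subset_UNIV
    by (induction z rule: frag_induction)
      (auto simp: list_subdivision_Suc Suc push_cone list_boundary_map simp del: list_subdivision.simps(2))
qed

lemma keys_list_subdivision:
  assumes "M \<in> Poly_Mapping.keys (list_subdivision l L)" "length L = l"
  shows "length M = l \<and> sorted_wrt (\<supseteq>) M \<and> (\<forall>A\<in>set M. A \<noteq> {} \<and> A \<subseteq> set L)"
  using assms
proof (induction l arbitrary: L M)
  case (Suc l)
  then obtain M' where M': "M = set L # M'"
      "M' \<in> Poly_Mapping.keys (frag_extend (list_subdivision l) (list_boundary L))"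
    using keys_cone[of "set L" "frag_extend (list_subdivision l) (list_boundary L)"] by auto
  then obtain L' where L': "L' \<in> Poly_Mapping.keys (list_boundary L)"
      "M' \<in> Poly_Mapping.keys (list_subdivision l L')"
    using keys_frag_extend[of "list_subdivision l" "list_boundary L"] by blast
  have "length L' = l" "set L' \<subseteq> set L" using keys_list_boundary[OF L'(1)] Suc.prems by auto
  then show ?case using Suc.IH[OF L'(2)] Suc.prems(2) M'(1) by auto
qed auto

lemma keys_subdivision:
  assumes "z \<in> ordered_chains K l" "M \<in> Poly_Mapping.keys (subdivision l z)"
  shows "length M = l \<and> sorted_wrt (\<supseteq>) M \<and> (\<exists>B\<in>K. \<forall>A\<in>set M. A \<noteq> {} \<and> A \<subseteq> B)"
proof -
  obtain L where "L \<in> Poly_Mapping.keys z" "M \<in> Poly_Mapping.keys (list_subdivision l L)"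
    using assms(2) keys_frag_extend[of "list_subdivision l" z] unfolding subdivision_def by blast
  then show ?thesis using keys_list_subdivision[of M l L] assms(1) unfolding ordered_chains_def by blast
qed

section \<open>A Tucker lemma for cyclic groups\<close>

lemma boundary_resolution_step:
  "boundary (resolution_step n g l z) = resolution_step n g l (boundary z)"
  by (simp add: resolution_step_def boundary_sum boundary_push)

lemma subdivision_resolution_step:
  "subdivision l (resolution_step n g k z) = resolution_step n (\<lambda>t. (`) (g t)) k (subdivision l z)"
  by (simp add: resolution_step_def subdivision_sum subdivision_push)

lemma push_resolution_step:
  assumes "\<And>t. push f (push (g t) z) = push (h t) (push f z)"
  shows "push f (resolution_step n g l z) = resolution_step n h l (push f z)"
  by (simp add: resolution_step_def push_sum assms)

text \<open>The norm of a cyclic group is annihilated by g - 1 on either side; in length zero,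
  \<open>g 1\<close> fixes the empty list. The condition \<open>g n = g 0\<close> stands for g^n =
  1, since \<open>rot\<close> by \<open>0\<close> still reduces modulo \<open>n\<close>.\<close>

lemma resolution_step_compose:
  assumes z: "z \<in> ordered_chains K l" and g: "\<And>t u. g t \<circ> g u = g (t + u)" "g n = g 0"
  shows "resolution_step n g (Suc l) (resolution_step n g l z) = 0"
proof (cases "l = 0")
  case True
  have "push (g 1) z = push (\<lambda>x. x) z"
    by (rule push_cong) (use z True in \<open>auto simp: ordered_chains_def\<close>)
  also have "\<dots> = z" unfolding push_def by (simp add: frag_expansion[symmetric])
  finally show ?thesis using True by (simp add: resolution_step_def)
next
  case False
  have *: "(\<Sum>t<n. push (g (Suc t)) z) = (\<Sum>t<n. push (g t) z)"
  proof -
    have "push (g 0) z + (\<Sum>t<n. push (g (Suc t)) z) = (\<Sum>t<Suc n. push (g t) z)"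
      by (rule sum.lessThan_Suc_shift[symmetric])
    also have "\<dots> = (\<Sum>t<n. push (g t) z) + push (g 0) z" by (simp add: g)
    finally show ?thesis by (simp add: add.commute)
  qed
  show ?thesis using False *
    by (cases "odd l") (simp_all add: resolution_step_def push_sum push_push g sum_subtractf)
qed

lemma acyclic_resolution:
  assumes acyc: "acyclic_upto N K" and inv: "\<And>t A. A \<in> K \<Longrightarrow> g t ` A \<in> K"
    and g: "\<And>t u. g t \<circ> g u = g (t + u)" "g n = g 0" and ne: "{} \<in> K"
  obtains X where "X 0 = frag_of []" "\<And>l. l \<le> N \<Longrightarrow> X l \<in> ordered_chains K l"
    "\<And>l. l < N \<Longrightarrow> boundary (X (Suc l)) = resolution_step n g l (X l)"
proof -
  let ?D = "resolution_step n g"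
  \<comment> \<open>\<open>P\<close> records that the differential of \<open>z\<close> is a cycle,
    so that acyclicity supplies its filling.\<close>
  define P where "P l z \<longleftrightarrow> (l = 0 \<longrightarrow> z = frag_of []) \<and>
    (l \<le> N \<longrightarrow> z \<in> ordered_chains K l \<and> boundary (?D l z) = 0)" for l z
  have "\<exists>X. \<forall>l. P l (X l) \<and> (l < N \<longrightarrow> boundary (X (Suc l)) = ?D l (X l))"
  proof (rule dependent_nat_choice)
    show "\<exists>z. P 0 z"
      by (rule exI[of _ "frag_of []"]) (simp add: P_def ordered_chains_def ne resolution_step_def)
    fix z l assume z: "P l z"
    show "\<exists>z'. P (Suc l) z' \<and> (l < N \<longrightarrow> boundary z' = ?D l z)"
    proof (cases "l < N")
      case True
      then have zc: "z \<in> ordered_chains K l" and "boundary (?D l z) = 0" using z by (auto simp: P_def)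
      moreover have "?D l z \<in> ordered_chains K l"
        unfolding resolution_step_def using zc inv
        by (auto intro!: ordered_chains_sum ordered_chains_diff ordered_chains_push)
      ultimately obtain z' where z': "z' \<in> ordered_chains K (Suc l)" "boundary z' = ?D l z"
        using acyc True unfolding acyclic_upto_def by blast
      moreover have "boundary (?D (Suc l) z') = 0"
        unfolding boundary_resolution_step z' by (rule resolution_step_compose[OF zc g])
      ultimately show ?thesis unfolding P_def by blast
    qed (auto simp: P_def)
  qed
  then obtain X where "\<forall>l. P l (X l) \<and> (l < N \<longrightarrow> boundary (X (Suc l)) = ?D l (X l))" by blast
  then show ?thesis using that[of X] unfolding P_def by blast
qed

text \<open>If no two neighbours have equal values, the values are positive and strictly decreasing,
  so the first is at least the length.\<close>

lemma length_le_or_adjacent: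
  fixes f :: "'a \<Rightarrow> nat"
  assumes "As \<noteq> []" "sorted_wrt (\<lambda>A B. f B \<le> f A) As" "\<forall>A\<in>set As. f A \<ge> 1"
  shows "length As \<le> f (hd As) \<or> (\<exists>xs A B ys. As = xs @ A # B # ys \<and> f A = f B)"
  using assms
proof (induction As)
  case (Cons A As)
  show ?case
  proof (cases As)
    case Nil
    then show ?thesis using Cons.prems by simp
  next
    case (Cons B Bs)
    have "length As \<le> f B \<or> (\<exists>xs C D ys. As = xs @ C # D # ys \<and> f C = f D)"
      using Cons.IH Cons.prems Cons by auto
    then consider "length As \<le> f B" "f A \<noteq> f B" | "f A = f B"
      | xs C D ys where "As = xs @ C # D # ys" "f C = f D" by blast
    then show ?thesis
    proof cases
      case 1
      then show ?thesis using Cons.prems Cons by auto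
    next
      case 2
      then show ?thesis using Cons by (metis append_Nil)
    next
      case 3
      then show ?thesis by (metis append_Cons)
    qed
  qed
qed auto

section \<open>The cyclic action on capped sets and the bound on the number of levels\<close>

definition shift :: "int \<Rightarrow> nat \<Rightarrow> 'i \<times> int \<Rightarrow> 'i \<times> int" where
  "shift n t v = (fst v, rot n t (snd v))"

lemma inj_on_rot: "inj_on (rot n t) {0..<n}"
proof (rule inj_onI)
  fix a b assume ab: "a \<in> {0..<n}" "b \<in> {0..<n}" and "rot n t a = rot n t b"
  then have "(rot n t a - int t) mod n = (rot n t b - int t) mod n" by simp
  then show "a = b" using ab by (simp add: rot_def mod_diff_left_eq)
qed

lemma capped_shift:
  assumes "finite I" "n > 0" "A \<in> capped (I \<times> {0..<n}) s"
  shows "shift n t ` A \<in> capped (I \<times> {0..<n}) s"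
proof -
  have "finite A" using assms finite_subset unfolding capped_def by blast
  have "card {v \<in> shift n t ` A. fst v = i} \<le> s i" for i
  proof -
    have "{v \<in> shift n t ` A. fst v = i} = shift n t ` {v \<in> A. fst v = i}"
      by (auto simp: shift_def)
    then have "card {v \<in> shift n t ` A. fst v = i} \<le> card {v \<in> A. fst v = i}"
      using \<open>finite A\<close> by (simp add: card_image_le)
    then show ?thesis using assms unfolding capped_def by (auto intro: le_trans)
  qed
  then show ?thesis using assms by (auto simp: capped_def shift_def rot_def)
qed

theorem cyclic_tucker:
  fixes I :: "'i set" and n :: nat and sgn :: "('i \<times> int) set \<Rightarrow> int" and lev :: "('i \<times> int) set \<Rightarrow> nat"
  assumes I: "finite I" and n: "n \<ge> 2" and s: "\<And>i. i \<in> I \<Longrightarrow> s i \<le> n"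
  defines "K \<equiv> capped (I \<times> {0..<int n}) s"
  assumes sgn: "\<And>A. A \<in> K \<Longrightarrow> A \<noteq> {} \<Longrightarrow> sgn A \<in> {0..<int n}"
    and equiv: "\<And>A t. A \<in> K \<Longrightarrow> A \<noteq> {} \<Longrightarrow> sgn (shift (int n) t ` A) = rot (int n) t (sgn A)"
    and lev: "\<And>A. A \<in> K \<Longrightarrow> A \<noteq> {} \<Longrightarrow> lev A \<in> {1..M}"
    and mono: "\<And>A B. B \<in> K \<Longrightarrow> A \<noteq> {} \<Longrightarrow> A \<subseteq> B \<Longrightarrow> lev A \<le> lev B"
    and strict: "\<And>A B. B \<in> K \<Longrightarrow> A \<noteq> {} \<Longrightarrow> A \<subseteq> B \<Longrightarrow> lev A = lev B \<Longrightarrow> sgn A = sgn B"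
  shows "(\<Sum>i\<in>I. s i) \<le> M"
proof (rule ccontr)
  assume "\<not> (\<Sum>i\<in>I. s i) \<le> M"
  define N where "N = (\<Sum>i\<in>I. s i)"
  have M: "M < N" using \<open>\<not> _\<close> N_def by simp
  let ?E = "I \<times> {0..<int n}"
  have finE: "finite ?E" using I by simp
  have down: "B \<in> K" if "A \<in> K" "B \<subseteq> A" for A B
    using capped_mono[OF finE] that unfolding K_def by blast
  have "card {v \<in> ?E. fst v = i} = n" if "i \<in> I" for i
  proof -
    have "{v \<in> ?E. fst v = i} = {i} \<times> {0..<int n}" using that by auto
    then show ?thesis by (simp add: card_cartesian_product)
  qed
  \<comment> \<open>As \<open>s i \<le> n\<close>, every minimum is \<open>s i\<close>, so the
    complex is acyclic up to the full sum.\<close>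
  then have "N = (\<Sum>i\<in>I. min (s i) (card {v \<in> ?E. fst v = i}))"
    unfolding N_def using s by (intro sum.cong) auto
  then have acyc: "acyclic_upto N K" unfolding K_def by (intro acyclic_upto_capped[OF finE I]) simp
  have comp: "shift (int n) t \<circ> shift (int n) u = shift (int n) (t + u)" for t u :: nat
    unfolding shift_def rot_def fun_eq_iff comp_def fst_conv snd_conv mod_add_left_eq
    by (simp add: add_ac)
  have per: "shift (int n) n = shift (int n) 0" by (auto simp: shift_def rot_def fun_eq_iff)
  have inv: "shift (int n) t ` A \<in> K" if "A \<in> K" for t A
    using capped_shift[OF I] that n unfolding K_def by auto
  have ne: "{} \<in> K" by (simp add: K_def capped_def)
  obtain X where X0: "X 0 = frag_of []" and XK: "\<And>l. l \<le> N \<Longrightarrow> X l \<in> ordered_chains K l"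
    and bX: "\<And>l. l < N \<Longrightarrow> boundary (X (Suc l)) = resolution_step n (shift (int n)) l (X l)"
    by (rule acyclic_resolution[OF acyc inv comp per ne]) (assumption, rule that)
  define Y where "Y l = subdivision l (X l)" for l
  define W where "W l = push sgn (Y l)" for l
  have keysY: "length As = l" "sorted_wrt (\<supseteq>) As" "\<forall>A\<in>set As. A \<in> K \<and> A \<noteq> {}"
    if "l \<le> N" "As \<in> Poly_Mapping.keys (Y l)" for l As
  proof -
    have *: "length As = l \<and> sorted_wrt (\<supseteq>) As \<and> (\<exists>B\<in>K. \<forall>A\<in>set As. A \<noteq> {} \<and> A \<subseteq> B)"
      using that keys_subdivision[OF XK] by (simp add: Y_def)
    then show "length As = l" "sorted_wrt (\<supseteq>) As" by simp_all
    from * obtain B where "B \<in> K" "\<forall>A\<in>set As. A \<noteq> {} \<and> A \<subseteq> B" by blast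
    then show "\<forall>A\<in>set As. A \<in> K \<and> A \<noteq> {}" using down by simp
  qed
  have keysW: "\<exists>As\<in>Poly_Mapping.keys (Y l). L = map sgn As" if "L \<in> Poly_Mapping.keys (W l)" for l L
    using that keys_push[of sgn "Y l"] unfolding W_def by blast
  \<comment> \<open>Length \<open>Suc M\<close> is within reach since \<open>M < N\<close>, and it
    exceeds the number of levels by one.\<close>
  have "[pairing (cyclic_cocycle (int n)) (W (Suc M)) = 1] (mod int n)"
  proof (rule pairing_cyclic_cocycle)
    show "W 0 = frag_of []" by (simp add: W_def Y_def X0)
    show "Poly_Mapping.keys (W l) \<subseteq> {L. length L = l \<and> set L \<subseteq> {0..<int n}}" if "l \<le> N" for l
    proof
      fix L assume "L \<in> Poly_Mapping.keys (W l)"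
      then obtain As where As: "As \<in> Poly_Mapping.keys (Y l)" "L = map sgn As" using keysW by blast
      have "sgn A \<in> {0..<int n}" if "A \<in> set As" for A
        using keysY(3)[OF \<open>l \<le> N\<close> As(1)] that sgn by blast
      then show "L \<in> {L. length L = l \<and> set L \<subseteq> {0..<int n}}"
        using keysY(1)[OF that As(1)] As(2) by auto
    qed
    fix l assume l: "l < N"
    have "Poly_Mapping.keys (X (Suc l)) \<subseteq> {L. length L = Suc l}"
      using XK[of "Suc l"] l unfolding ordered_chains_def by auto
    then have bY: "boundary (Y (Suc l)) = resolution_step n (\<lambda>t. (`) (shift (int n) t)) l (Y l)"
      unfolding Y_def using bX[OF l] by (simp only: boundary_subdivision subdivision_resolution_step)
    have "push sgn (push ((`) (shift (int n) t)) (Y l)) = push (rot (int n) t) (push sgn (Y l))" for t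
      unfolding push_push
    proof (rule push_cong)
      fix As assume "As \<in> Poly_Mapping.keys (Y l)"
      then have "\<forall>A\<in>set As. A \<in> K \<and> A \<noteq> {}" by (rule keysY(3)[OF less_imp_le[OF l]])
      then show "map (sgn \<circ> (`) (shift (int n) t)) As = map (rot (int n) t \<circ> sgn) As"
        by (auto simp: equiv)
    qed
    then show "boundary (W (Suc l)) = resolution_step n (rot (int n)) l (W l)"
      unfolding W_def boundary_push bY by (rule push_resolution_step)
  qed (use n M in auto)
  moreover have "pairing (cyclic_cocycle (int n)) (W (Suc M)) = pairing (\<lambda>_. 0) (W (Suc M))"
  proof (rule pairing_cong[OF subset_refl])
    fix L assume "L \<in> Poly_Mapping.keys (W (Suc M))"
    then obtain As where As: "As \<in> Poly_Mapping.keys (Y (Suc M))" "L = map sgn As" using keysW by blast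
    have len: "length As = Suc M" and sorted: "sorted_wrt (\<supseteq>) As"
      and AK: "\<forall>A\<in>set As. A \<in> K \<and> A \<noteq> {}"
      using keysY[OF _ As(1)] M by auto
    have ne: "As \<noteq> []" using len by auto
    have "sorted_wrt (\<lambda>A B. lev B \<le> lev A) As"
      by (rule sorted_wrt_mono_rel[OF _ sorted]) (use AK mono in auto)
    moreover have "\<forall>A\<in>set As. lev A \<ge> 1" using AK lev by force
    moreover have "lev (hd As) \<le> M" using AK ne lev by force
    \<comment> \<open>A flag of \<open>Suc M\<close> sets has two neighbours on the same level,
      hence with the same sign, and the cocycle vanishes on the resulting degenerate list.\<close>
    ultimately obtain xs A B ys where AB: "As = xs @ A # B # ys" "lev A = lev B"
      using length_le_or_adjacent[OF ne, of lev] len by auto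
    have "B \<subseteq> A" using sorted AB by (simp add: sorted_wrt_append)
    then have "sgn B = sgn A" using AK AB strict[of A B] by simp
    then have "L = map sgn xs @ sgn A # sgn A # map sgn ys" using As AB by simp
    then show "cyclic_cocycle (int n) L = 0" by (simp only: cyclic_cocycle_adjacent)
  qed
  moreover have "pairing (\<lambda>_. 0) z = 0" for z :: "int list \<Rightarrow>\<^sub>0 int"
    using pairing_mult[of 0 "\<lambda>_. 0" z] by simp
  ultimately have "[0 = 1] (mod int n)" by simp
  then show False using n by (simp add: cong_def)
qed

section \<open>Prime uniformity\<close>

text \<open>A nonempty proper subset \<open>B\<close> of the residues modulo a prime has an invertible cardinality,
  so its mean is defined; it is an equivariant choice of a residue for \<open>B\<close>.\<close>

definition residue_mean :: "nat \<Rightarrow> int set \<Rightarrow> int" where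
  "residue_mean p B = (\<Sum>B * (SOME x. [int (card B) * x = 1] (mod int p))) mod int p"

lemma residue_mean_range: "p > 0 \<Longrightarrow> residue_mean p B \<in> {0..<int p}"
  by (simp add: residue_mean_def)

text \<open>Rotation adds \<open>card B * t\<close> to the sum modulo \<open>p\<close>, and the
  inverse of \<open>card B\<close> turns this into \<open>t\<close>; the cardinality, and with it
  the chosen inverse, is preserved.\<close>

lemma residue_mean_rot:
  assumes p: "prime p" and B: "B \<subset> {0..<int p}" "B \<noteq> {}"
  shows "residue_mean p (rot (int p) t ` B) = rot (int p) t (residue_mean p B)"
proof -
  have fin: "finite B" using B finite_subset by auto
  have "card B < p" using psubset_card_mono[OF _ B(1)] by simp
  moreover have "card B > 0" using fin B by auto
  ultimately have "coprime (card B) p"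
    using p by (metis coprime_commute dvd_imp_le leD prime_imp_coprime)
  then have "\<exists>x. [int (card B) * x = 1] (mod int p)"
    using cong_solve_coprime_int coprime_int_iff by blast
  define x where "x = (SOME x. [int (card B) * x = 1] (mod int p))"
  have x: "[int (card B) * x = 1] (mod int p)"
    unfolding x_def by (rule someI_ex) fact
  have inj: "inj_on (rot (int p) t) B" using inj_on_rot B by (meson inj_on_subset psubset_imp_subset)
  have "[(\<Sum>b\<in>B. rot (int p) t b) = (\<Sum>b\<in>B. b + int t)] (mod int p)"
    by (rule cong_sum) (simp add: rot_def cong_def)
  then have "[(\<Sum>b\<in>B. rot (int p) t b) * x = (\<Sum>b\<in>B. b + int t) * x] (mod int p)"
    by (rule cong_scalar_right)
  also have "(\<Sum>b\<in>B. b + int t) * x = \<Sum>B * x + int t * (int (card B) * x)"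
    by (simp add: sum.distrib algebra_simps)
  also have "[\<dots> = \<Sum>B * x + int t * 1] (mod int p)"
    by (intro cong_add cong_mult x) auto
  finally have "[(\<Sum>b\<in>B. rot (int p) t b) * x = \<Sum>B * x + int t] (mod int p)" by simp
  moreover have "\<Sum>(rot (int p) t ` B) = (\<Sum>b\<in>B. rot (int p) t b)" by (simp add: sum.reindex[OF inj])
  ultimately show ?thesis
    unfolding residue_mean_def card_image[OF inj] x_def[symmetric]
    by (simp add: rot_def[of _ _ "_ mod _"] cong_def mod_add_left_eq)
qed

text \<open>Rotating all members keeps the index of the first nonempty one, so equivariance is
  inherited from \<open>residue_mean\<close>.\<close>

definition family_sign :: "nat \<Rightarrow> (nat \<Rightarrow> int set) \<Rightarrow> int" where
  "family_sign p F = residue_mean p (F (LEAST i. F i \<noteq> {}))"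

lemma family_sign_rot:
  assumes "prime p" "\<And>i. F i \<subset> {0..<int p}" "F i \<noteq> {}"
  shows "family_sign p (\<lambda>i. rot (int p) t ` F i) = rot (int p) t (family_sign p F)"
proof -
  have "F (LEAST i. F i \<noteq> {}) \<noteq> {}" using assms(3) by (rule LeastI)
  then show ?thesis using residue_mean_rot[OF assms(1) assms(2)] by (simp add: family_sign_def)
qed

text \<open>The ground set is arbitrary because the reductions below change it; an indexed family
  takes the place of a multiset.\<close>

definition has_monochromatic_edge ::
    "nat \<Rightarrow> (nat \<Rightarrow> nat) \<Rightarrow> nat set \<Rightarrow> nat \<Rightarrow> (nat set \<Rightarrow> nat) \<Rightarrow> bool" where
  "has_monochromatic_edge r s I k c \<longleftrightarrow> (\<exists>A j. (\<forall>t<r. A t \<subseteq> I \<and> card (A t) = k \<and> c (A t) = j) \<and>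
     (\<forall>i\<in>I. card {t. t < r \<and> i \<in> A t} \<le> s i))"

definition layer :: "(nat \<times> int) set \<Rightarrow> int \<Rightarrow> nat set" where
  "layer A a = {i. (i, a) \<in> A}"

definition fibre :: "(nat \<times> int) set \<Rightarrow> nat \<Rightarrow> int set" where
  "fibre A i = {a. (i, a) \<in> A}"

definition color_fibre :: "nat \<Rightarrow> nat \<Rightarrow> (nat set \<Rightarrow> nat) \<Rightarrow> (nat \<times> int) set \<Rightarrow> nat \<Rightarrow> int set" where
  "color_fibre p k c A j = {a \<in> {0..<int p}. \<exists>B\<subseteq>layer A a. card B = k \<and> c B = j}"

lemma bij_betw_rot: "n > 0 \<Longrightarrow> bij_betw (rot n t) {0..<n} {0..<n}"
  by (rule bij_betw_imageI[OF inj_on_rot], rule endo_inj_surj[OF _ _ inj_on_rot]) (auto simp: rot_def)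

lemma layer_shift:
  assumes "A \<subseteq> I \<times> {0..<n}" "a \<in> {0..<n}"
  shows "layer (shift n t ` A) (rot n t a) = layer A a"
  using assms inj_onD[OF inj_on_rot, of n t a] by (force simp: layer_def shift_def image_iff)

lemma fibre_shift: "fibre (shift n t ` A) i = rot n t ` fibre A i"
  by (force simp: fibre_def shift_def image_iff)

lemma color_fibre_shift:
  assumes "A \<subseteq> I \<times> {0..<int p}" "p > 0"
  shows "color_fibre p k c (shift (int p) t ` A) j = rot (int p) t ` color_fibre p k c A j"
proof -
  have "{0..<int p} = rot (int p) t ` {0..<int p}"
    using bij_betw_rot[of "int p" t] assms(2) by (simp add: bij_betw_def)
  then have "color_fibre p k c (shift (int p) t ` A) j =
      {b \<in> rot (int p) t ` {0..<int p}. \<exists>B\<subseteq>layer (shift (int p) t ` A) b. card B = k \<and> c B = j}"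
    by (simp add: color_fibre_def)
  also have "\<dots> = rot (int p) t ` {a \<in> {0..<int p}.
      \<exists>B\<subseteq>layer (shift (int p) t ` A) (rot (int p) t a). card B = k \<and> c B = j}"
    by blast
  also have "\<dots> = rot (int p) t ` color_fibre p k c A j"
    unfolding color_fibre_def using layer_shift[OF assms(1)] by (simp cong: conj_cong)
  finally show ?thesis .
qed

lemma card_eq_sum_layers:
  assumes "finite A" "A \<subseteq> I \<times> {0..<n}"
  shows "card A = (\<Sum>a\<in>{0..<n}. card (layer A a))"
proof -
  have "card A = (\<Sum>a\<in>{0..<n}. card {v \<in> A. snd v = a})"
    using assms by (subst card_eq_sum, subst sum.group[symmetric, of A "{0..<n}" snd]) auto
  also have "\<dots> = (\<Sum>a\<in>{0..<n}. card (layer A a))"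
  proof (rule sum.cong[OF refl])
    fix a
    have "{v \<in> A. snd v = a} = (\<lambda>i. (i, a)) ` layer A a" by (auto simp: layer_def image_iff)
    then show "card {v \<in> A. snd v = a} = card (layer A a)" by (simp add: card_image inj_on_def)
  qed
  finally show ?thesis .
qed

text \<open>One \<open>k\<close>-set of color \<open>j\<close> is taken from each layer; those
  containing \<open>i\<close> inject into the points of \<open>A\<close> over \<open>i\<close>, of
  which there are at most \<open>s i\<close>.\<close>

lemma monochromatic_edge_of_full_color_fibre:
  assumes A: "A \<in> capped (I \<times> {0..<int p}) s" "finite I"
    and full: "{0..<int p} \<subseteq> color_fibre p k c A j"
  shows "has_monochromatic_edge p s I k c"
proof -
  have "\<forall>t<p. \<exists>B. B \<subseteq> layer A (int t) \<and> card B = k \<and> c B = j"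
  proof (intro allI impI)
    fix t assume "t < p"
    then have "int t \<in> color_fibre p k c A j" using full by auto
    then show "\<exists>B. B \<subseteq> layer A (int t) \<and> card B = k \<and> c B = j" unfolding color_fibre_def by blast
  qed
  then obtain B where B: "\<And>t. t < p \<Longrightarrow> B t \<subseteq> layer A (int t) \<and> card (B t) = k \<and> c (B t) = j"
    by metis
  have AE: "A \<subseteq> I \<times> {0..<int p}" using A by (simp add: capped_def)
  have finA: "finite A" using finite_subset[OF AE] A by simp
  have "card {t. t < p \<and> i \<in> B t} \<le> s i" for i
  proof -
    have "card {t. t < p \<and> i \<in> B t} = card ((\<lambda>t. (i, int t)) ` {t. t < p \<and> i \<in> B t})"
      by (rule card_image[symmetric]) (auto simp: inj_on_def)
    also have "\<dots> \<le> card {v \<in> A. fst v = i}"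
      using finA B by (intro card_mono) (auto simp: layer_def)
    also have "\<dots> \<le> s i" using A by (simp add: capped_def)
    finally show ?thesis .
  qed
  moreover have "\<forall>t<p. B t \<subseteq> I \<and> card (B t) = k \<and> c (B t) = j"
    using B AE by (fastforce simp: layer_def)
  ultimately show ?thesis unfolding has_monochromatic_edge_def by blast
qed

lemma prime_monochromatic_edge:
  assumes p: "prime p" and I: "finite I" and s: "\<And>i. i \<in> I \<Longrightarrow> s i < p" and k: "k \<ge> 1"
    and c: "\<And>A. A \<subseteq> I \<Longrightarrow> card A = k \<Longrightarrow> c A < m"
    and big: "p * (k - 1) + (p - 1) * m < (\<Sum>i\<in>I. s i)"
  shows "has_monochromatic_edge p s I k c"
proof (rule ccontr)
  assume no: "\<not> has_monochromatic_edge p s I k c"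
  define K where "K = capped (I \<times> {0..<int p}) s"
  define large where "large A \<longleftrightarrow> (\<exists>a\<in>{0..<int p}. card (layer A a) \<ge> k)" for A
  define S where "S = color_fibre p k c"
  \<comment> \<open>Both families consist of proper subsets of the residues, as the mean requires:
    the fibres because \<open>s i < p\<close>, the color sets because no hyperedge is
    monochromatic.\<close>
  define sgn where "sgn A = family_sign p (if large A then S A else fibre A)" for A
  define lev where "lev A = (if large A then p * (k - 1) + (\<Sum>j<m. card (S A j)) else card A)" for A
  have p2: "p \<ge> 2" using p by (rule prime_ge_2_nat)
  have KE: "A \<subseteq> I \<times> {0..<int p}" if "A \<in> K" for A using that by (simp add: K_def capped_def)
  have finK: "finite A" if "A \<in> K" for A using finite_subset[OF KE[OF that]] I by simp
  have finl: "finite (layer A a)" if "A \<in> K" for A a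
    using finite_subset[of "layer A a" I] KE[OF that] I by (auto simp: layer_def)
  have down: "B \<in> K" if "A \<in> K" "B \<subseteq> A" for A B
    using that capped_mono[of "I \<times> {0..<int p}"] I unfolding K_def by blast
  have fibre_proper: "fibre A i \<subset> {0..<int p}" if "A \<in> K" for A i
  proof -
    have sub: "fibre A i \<subseteq> {0..<int p}" using KE[OF that] by (auto simp: fibre_def)
    have "card (fibre A i) = card ((\<lambda>a. (i, a)) ` fibre A i)"
      by (rule card_image[symmetric]) (auto simp: inj_on_def)
    also have "(\<lambda>a. (i, a)) ` fibre A i = {v \<in> A. fst v = i}" by (auto simp: fibre_def image_iff)
    also have "card \<dots> < p"
    proof (cases "i \<in> I")
      case True
      then show ?thesis using that s[OF True] unfolding K_def capped_def by (auto intro: le_less_trans)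
    next
      case False
      then have "{v \<in> A. fst v = i} = {}" using KE[OF that] by auto
      then show ?thesis using p2 by (simp only: card.empty)
    qed
    finally show ?thesis using sub by auto
  qed
  have S_proper: "S A j \<subset> {0..<int p}" if "A \<in> K" for A j
    using monochromatic_edge_of_full_color_fibre[of A I p s k c j] no that I
    unfolding K_def S_def color_fibre_def by blast
  have finS: "finite (S A j)" for A j
    by (rule finite_subset[of _ "{0..<int p}"]) (auto simp: S_def color_fibre_def)
  have S_nonempty: "\<exists>j<m. S A j \<noteq> {}" if A: "A \<in> K" "large A" for A
  proof -
    obtain a where a: "a \<in> {0..<int p}" "card (layer A a) \<ge> k" using A unfolding large_def by blast
    then obtain B where B: "B \<subseteq> layer A a" "card B = k" by (meson obtain_subset_with_card_n)
    have "B \<subseteq> I" using B KE[OF A(1)] by (auto simp: layer_def)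
    then have "c B < m" using c B by blast
    moreover have "a \<in> S A (c B)" using a B unfolding S_def color_fibre_def by blast
    ultimately show ?thesis by blast
  qed
  \<comment> \<open>Colors outside the range are covered too, because \<open>family_sign\<close>
    looks at all indices.\<close>
  have S_empty: "S A j = {}" if A: "A \<in> K" "\<not> j < m" for A j
  proof (rule ccontr)
    assume "S A j \<noteq> {}"
    then obtain a B where B: "B \<subseteq> layer A a" "card B = k" "c B = j"
      unfolding S_def color_fibre_def by blast
    then have "B \<subseteq> I" using KE[OF A(1)] by (auto simp: layer_def)
    then show False using c B A by blast
  qed
  have fibre_nonempty: "\<exists>i. fibre A i \<noteq> {}" if "A \<noteq> {}" for A using that by (force simp: fibre_def)
  have large_shift: "large (shift (int p) t ` A) \<longleftrightarrow> large A" if "A \<in> K" for t A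
  proof -
    have im: "{0..<int p} = rot (int p) t ` {0..<int p}"
      using bij_betw_rot[of "int p" t] p2 by (simp add: bij_betw_def)
    show ?thesis unfolding large_def
      by (subst im) (simp add: layer_shift[OF KE[OF that]] del: atLeastLessThan_iff)
  qed
  have layer_mono: "layer A a \<subseteq> layer B a" if "A \<subseteq> B" for A B a using that by (auto simp: layer_def)
  have large_mono: "large B" if "B \<in> K" "A \<subseteq> B" "large A" for A B
    using that card_mono[OF finl[OF that(1)] layer_mono[OF that(2)]] unfolding large_def
    by (meson le_trans)
  have S_mono: "S A j \<subseteq> S B j" if "A \<subseteq> B" for A B j
    using layer_mono[OF that] unfolding S_def color_fibre_def by blast
  have small: "card A \<le> p * (k - 1)" if "A \<in> K" "\<not> large A" for A
  proof -
    have "card A = (\<Sum>a\<in>{0..<int p}. card (layer A a))"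
      by (rule card_eq_sum_layers[OF finK[OF that(1)] KE[OF that(1)]])
    also have "\<dots> \<le> (\<Sum>a\<in>{0..<int p}. k - 1)"
      using that(2) unfolding large_def by (intro sum_mono) force
    finally show ?thesis by simp
  qed
  have "(\<Sum>i\<in>I. s i) \<le> p * (k - 1) + (p - 1) * m"
  proof (rule cyclic_tucker[where n = p and sgn = sgn and lev = lev])
    show "finite I" "p \<ge> 2" by fact+
    show "s i \<le> p" if "i \<in> I" for i using s[OF that] by simp
  next
    fix A assume "A \<in> capped (I \<times> {0..<int p}) s" "A \<noteq> {}"
    then have A: "A \<in> K" "A \<noteq> {}" by (simp_all add: K_def)
    show "sgn A \<in> {0..<int p}"
      unfolding sgn_def family_sign_def using residue_mean_range p2 by simp
    show "sgn (shift (int p) t ` A) = rot (int p) t (sgn A)" for t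
    proof (cases "large A")
      case True
      have "S (shift (int p) t ` A) = (\<lambda>j. rot (int p) t ` S A j)"
        unfolding S_def using color_fibre_shift[OF KE[OF A(1)]] p2 by auto
      moreover obtain j where "S A j \<noteq> {}" using S_nonempty[OF A(1) True] by blast
      ultimately show ?thesis
        using True family_sign_rot[OF p S_proper[OF A(1)]] by (simp add: sgn_def large_shift[OF A(1)])
    next
      case False
      have "fibre (shift (int p) t ` A) = (\<lambda>i. rot (int p) t ` fibre A i)"
        by (simp add: fun_eq_iff fibre_shift)
      moreover obtain i where "fibre A i \<noteq> {}" using fibre_nonempty[OF A(2)] by blast
      ultimately show ?thesis
        using False family_sign_rot[OF p fibre_proper[OF A(1)]] by (simp add: sgn_def large_shift[OF A(1)])
    qed
    show "lev A \<in> {1..p * (k - 1) + (p - 1) * m}"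
    proof (cases "large A")
      case True
      obtain j where j: "j < m" "S A j \<noteq> {}" using S_nonempty[OF A(1) True] by blast
      have "card (S A j) > 0" using j finS by (simp add: card_gt_0_iff)
      then have "(\<Sum>j<m. card (S A j)) \<ge> 1"
        using j member_le_sum[of j "{..<m}" "\<lambda>j. card (S A j)"] by simp
      moreover have "(\<Sum>j<m. card (S A j)) \<le> (\<Sum>j<m. p - 1)"
      proof (rule sum_mono)
        fix j
        have "card (S A j) < p" using psubset_card_mono[OF _ S_proper[OF A(1), of j]] by simp
        then show "card (S A j) \<le> p - 1" by simp
      qed
      ultimately show ?thesis using True by (simp add: lev_def mult.commute)
    next
      case False
      have "card A > 0" using A finK by (simp add: card_gt_0_iff)
      then show ?thesis using False small[OF A(1)] by (simp add: lev_def)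
    qed
  next
    fix A B assume "B \<in> capped (I \<times> {0..<int p}) s" and ne: "A \<noteq> {}" and AB: "A \<subseteq> B"
    then have B: "B \<in> K" by (simp add: K_def)
    have A: "A \<in> K" using down[OF B AB] .
    have cS: "card (S A j) \<le> card (S B j)" for j using finS S_mono[OF AB] by (rule card_mono)
    have pos: "1 \<le> (\<Sum>j<m. card (S B j))" if lB: "large B"
    proof -
      obtain j where j: "j < m" "S B j \<noteq> {}" using S_nonempty[OF B lB] by blast
      have "card (S B j) > 0" using j finS by (simp add: card_gt_0_iff)
      then show ?thesis using j member_le_sum[of j "{..<m}" "\<lambda>j. card (S B j)"] by simp
    qed
    consider "large A" "large B" | "\<not> large A" "large B" | "\<not> large A" "\<not> large B"
      using large_mono[OF B AB] by blast
    then have "lev A \<le> lev B \<and> (lev A = lev B \<longrightarrow> sgn A = sgn B)"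
    proof cases
      case 1
      \<comment> \<open>Monotone cardinalities with equal sums agree termwise, so the nested color
        sets coincide.\<close>
      have "S A = S B" if "lev A = lev B"
      proof
        fix j
        show "S A j = S B j"
        proof (cases "j < m")
          case True
          have "(\<Sum>j<m. card (S A j)) = (\<Sum>j<m. card (S B j))" using that 1 by (simp add: lev_def)
          then have "card (S A j) = card (S B j)"
            using sum_mono_inv[of "\<lambda>j. card (S A j)" "{..<m}" "\<lambda>j. card (S B j)" j] cS True by simp
          then show ?thesis using card_subset_eq[OF finS S_mono[OF AB]] by simp
        next
          case False
          then show ?thesis using S_empty A B by simp
        qed
      qed
      then show ?thesis using 1 cS by (auto simp: lev_def sgn_def intro!: sum_mono)
    next
      case 2
      then have "lev A < lev B" using small[OF A] pos by (simp add: lev_def)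
      then show ?thesis by simp
    next
      case 3
      then have "lev A = card A" "lev B = card B" by (simp_all add: lev_def)
      then show ?thesis using card_mono[OF finK[OF B] AB] card_subset_eq[OF finK[OF B] AB] by auto
    qed
    then show "lev A \<le> lev B" "lev A = lev B \<Longrightarrow> sgn A = sgn B" by blast+
  qed
  then show False using big by simp
qed

section \<open>Composite uniformity\<close>

text \<open>The cap \<open>M\<close> is a parameter of its own, so that it can be raised from
  \<open>r - 1\<close> to \<open>r\<close> and multiplied along with \<open>r\<close>.\<close>

definition kneser_property :: "nat \<Rightarrow> nat \<Rightarrow> bool" where
  "kneser_property r M \<longleftrightarrow> (\<forall>I s k m c. finite I \<longrightarrow> (\<forall>i\<in>I. s i \<le> M) \<longrightarrow> k \<ge> 1 \<longrightarrow>
     (\<forall>A\<subseteq>I. card A = k \<longrightarrow> c A < m) \<longrightarrow> r * (k - 1) + (r - 1) * m < (\<Sum>i\<in>I. s i) \<longrightarrow>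
     has_monochromatic_edge r s I k c)"

lemma kneser_propertyD:
  assumes "kneser_property r M" "finite I" "\<And>i. i \<in> I \<Longrightarrow> s i \<le> M" "k \<ge> 1"
    "\<And>A. A \<subseteq> I \<Longrightarrow> card A = k \<Longrightarrow> c A < m" "r * (k - 1) + (r - 1) * m < (\<Sum>i\<in>I. s i)"
  shows "has_monochromatic_edge r s I k c"
  using assms(2-6) by (rule assms(1)[unfolded kneser_property_def, rule_format])

text \<open>The points with multiplicity bound \<open>r\<close> impose no condition: either they contain a \<open>k\<close>-set,
  which repeated \<open>r\<close> times is a hyperedge, or they can be added to every set.\<close>

lemma kneser_property_extend:
  assumes r: "r \<ge> 1" and below: "kneser_property r (r - 1)"
  shows "kneser_property r r"
  unfolding kneser_property_def
proof (intro allI impI)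
  fix I s k m and c :: "nat set \<Rightarrow> nat"
  assume I: "finite I" and s: "\<forall>i\<in>I. s i \<le> r" and k: "k \<ge> 1"
    and c: "\<forall>A\<subseteq>I. card A = k \<longrightarrow> c A < m" and big: "r * (k - 1) + (r - 1) * m < (\<Sum>i\<in>I. s i)"
  define D where "D = {i \<in> I. s i = r}"
  have DI: "D \<subseteq> I" and finD: "finite D" using I by (auto simp: D_def)
  have count: "card {t. t < r \<and> P t} \<le> r" for P
    using card_mono[of "{..<r}" "{t. t < r \<and> P t}"] by auto
  show "has_monochromatic_edge r s I k c"
  proof (cases "k \<le> card D")
    case True
    then obtain A where A: "A \<subseteq> D" "card A = k" by (meson obtain_subset_with_card_n)
    have "card {t. t < r \<and> i \<in> A} \<le> s i" for i
      using A count[of "\<lambda>_. True"] by (cases "i \<in> A") (auto simp: D_def)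
    then show ?thesis unfolding has_monochromatic_edge_def
      using A DI by (intro exI[of _ "\<lambda>_. A"] exI[of _ "c A"]) auto
  next
    case False
    define k' where "k' = k - card D"
    have k': "k' \<ge> 1" "k = k' + card D" using False by (auto simp: k'_def)
    have cardD: "card (A \<union> D) = card A + card D" if "A \<subseteq> I - D" for A
      using that I finD by (intro card_Un_disjoint) (auto intro: finite_subset)
    have "(\<Sum>i\<in>I. s i) = (\<Sum>i\<in>I - D. s i) + (\<Sum>i\<in>D. s i)"
      using I DI by (rule sum.subset_diff[rotated])
    also have "(\<Sum>i\<in>D. s i) = r * card D" by (simp add: D_def)
    \<comment> \<open>Removing \<open>D\<close> lowers \<open>k\<close> by \<open>card D\<close>, so
      both sides drop by \<open>r * card D\<close>.\<close>
    finally have 1: "r * (k' - 1) + (r - 1) * m < (\<Sum>i\<in>I - D. s i)"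
      using big k' by (cases k') (auto simp: algebra_simps)
    have 2: "s i \<le> r - 1" if "i \<in> I - D" for i
    proof -
      have "s i \<le> r" "s i \<noteq> r" using that s by (auto simp: D_def)
      then show ?thesis by simp
    qed
    have 3: "c (A \<union> D) < m" if "A \<subseteq> I - D" "card A = k'" for A
    proof -
      have "A \<union> D \<subseteq> I" "card (A \<union> D) = k" using that cardD DI k'(2) by auto
      then show ?thesis using c by simp
    qed
    have "has_monochromatic_edge r s (I - D) k' (\<lambda>A. c (A \<union> D))"
      using I by (intro kneser_propertyD[OF below _ 2 k'(1) 3 1]) auto
    then obtain A j where A: "\<And>t. t < r \<Longrightarrow> A t \<subseteq> I - D \<and> card (A t) = k' \<and> c (A t \<union> D) = j"
      and deg: "\<And>i. i \<in> I - D \<Longrightarrow> card {t. t < r \<and> i \<in> A t} \<le> s i"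
      unfolding has_monochromatic_edge_def by blast
    have "card {t. t < r \<and> i \<in> A t \<union> D} \<le> s i" if "i \<in> I" for i
    proof (cases "i \<in> D")
      case True
      then have "s i = r" by (simp add: D_def)
      then show ?thesis using count by simp
    next
      case False
      then show ?thesis using deg[of i] that by simp
    qed
    moreover have "A t \<union> D \<subseteq> I \<and> card (A t \<union> D) = k \<and> c (A t \<union> D) = j" if "t < r" for t
      using A[OF that] cardD DI k'(2) by auto
    ultimately show ?thesis unfolding has_monochromatic_edge_def
      by (intro exI[of _ "\<lambda>t. A t \<union> D"] exI[of _ j]) simp
  qed
qed

lemma kneser_property_prime:
  assumes "prime p"
  shows "kneser_property p p"
proof (rule kneser_property_extend)
  show "p \<ge> 1" using prime_ge_1_nat[OF assms] .
  show "kneser_property p (p - 1)"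
    unfolding kneser_property_def
  proof (intro allI impI)
    fix I s k m and c :: "nat set \<Rightarrow> nat"
    assume "finite I" and s: "\<forall>i\<in>I. s i \<le> p - 1" and "k \<ge> 1"
      and "\<forall>A\<subseteq>I. card A = k \<longrightarrow> c A < m" and "p * (k - 1) + (p - 1) * m < (\<Sum>i\<in>I. s i)"
    moreover have "s i < p" if "i \<in> I" for i using s that prime_gt_0_nat[OF assms] by fastforce
    ultimately show "has_monochromatic_edge p s I k c"
      by (intro prime_monochromatic_edge[OF assms]) auto
  qed
qed

section \<open>Products of uniformities\<close>

lemma sum_min_blocks: "(\<Sum>l<M. min L (x - L * l)) = min x (L * M)" for x L M :: nat
proof (induction M)
  case (Suc M)
  have "min L (x - y) + min x y = min x (L + y)" for y by (auto simp: min_def)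
  then show ?case using Suc by (simp add: add.commute)
qed simp

lemma sum_card_swap:
  fixes R :: "nat \<Rightarrow> nat \<Rightarrow> bool"
  shows "(\<Sum>u<b. card {l. l < M \<and> R u l}) = (\<Sum>l<M. card {u. u < b \<and> R u l})"
proof -
  have *: "card {l. l < n \<and> P l} = (\<Sum>l<n. if P l then 1 else 0)" for n :: nat and P
    by (simp add: sum.If_cases Int_def)
  show ?thesis unfolding * by (rule sum.swap)
qed

lemma card_div_mod_le:
  fixes a b :: nat
  assumes "a > 0"
  shows "card {q. q < a * b \<and> P (q div a) (q mod a)} \<le> (\<Sum>u<b. card {v. v < a \<and> P u v})"
proof -
  let ?S = "SIGMA u:{..<b}. {v. v < a \<and> P u v}"
  have "{q. q < a * b \<and> P (q div a) (q mod a)} \<subseteq> (\<lambda>(u, v). u * a + v) ` ?S"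
  proof
    fix q assume q: "q \<in> {q. q < a * b \<and> P (q div a) (q mod a)}"
    then have "q div a < b" using assms by (simp add: div_less_iff_less_mult mult.commute)
    then show "q \<in> (\<lambda>(u, v). u * a + v) ` ?S"
      using q assms by (intro image_eqI[of _ _ "(q div a, q mod a)"]) auto
  qed
  then have "card {q. q < a * b \<and> P (q div a) (q mod a)} \<le> card ((\<lambda>(u, v). u * a + v) ` ?S)"
    by (intro card_mono) auto
  also have "\<dots> \<le> card ?S" by (rule card_image_le) auto
  also have "\<dots> = (\<Sum>u<b. card {v. v < a \<and> P u v})" by simp
  finally show ?thesis .
qed

text \<open>Each bound \<open>s i\<close> is split into \<open>M\<close> bounds at most \<open>L\<close> on the points \<open>(i, l)\<close>. A set \<open>T\<close> of
  such points defines the vector counting its points over each \<open>i\<close>; if \<open>T\<close> is large enough, this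
  vector admits a monochromatic \<open>a\<close>-edge, whose color is given to \<open>T\<close>.\<close>

lemma kneser_property_mult:
  assumes a: "a \<ge> 1" and b: "b \<ge> 1" and pa: "kneser_property a M" and pb: "kneser_property b L"
  shows "kneser_property (a * b) (M * L)"
  unfolding kneser_property_def
proof (intro allI impI)
  fix I s k m and c :: "nat set \<Rightarrow> nat"
  assume I: "finite I" and s: "\<forall>i\<in>I. s i \<le> M * L" and k: "k \<ge> 1"
    and c: "\<forall>A\<subseteq>I. card A = k \<longrightarrow> c A < m"
    and big: "a * b * (k - 1) + (a * b - 1) * m < (\<Sum>i\<in>I. s i)"
  \<comment> \<open>The least size of \<open>T\<close> at which the vector \<open>w T\<close>
    exceeds the bound for \<open>a\<close>.\<close>
  define k' where "k' = a * (k - 1) + (a - 1) * m + 1"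
  define J where "J = prod_encode ` (I \<times> {..<M})"
  \<comment> \<open>Block \<open>l\<close> receives what remains of \<open>s i\<close> after
    \<open>l\<close> full blocks, at most \<open>L\<close>; truncated subtraction leaves the later
    blocks empty.\<close>
  define s' where "s' x = (case prod_decode x of (i, l) \<Rightarrow> min L (s i - L * l))" for x
  define w where "w T i = card {l. l < M \<and> prod_encode (i, l) \<in> T}" for T i
  have finJ: "finite J" using I by (simp add: J_def)
  define P where "P T A j \<longleftrightarrow> (\<forall>t<a. A t \<subseteq> I \<and> card (A t) = k \<and> c (A t) = j) \<and>
      (\<forall>i\<in>I. card {t. t < a \<and> i \<in> A t} \<le> w T i)" for T A j
  have ex: "\<exists>A j. P T A j" if T: "T \<subseteq> J" "card T = k'" for T
  proof -
    have "T = prod_encode ` (SIGMA i:I. {l. l < M \<and> prod_encode (i, l) \<in> T})"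
      using T(1) by (auto simp: J_def)
    then have "card T = card (SIGMA i:I. {l. l < M \<and> prod_encode (i, l) \<in> T})"
      by (metis (no_types, lifting) card_image inj_on_subset inj_prod_encode subset_UNIV)
    also have "\<dots> = (\<Sum>i\<in>I. w T i)" using I by (simp add: w_def)
    finally have 1: "a * (k - 1) + (a - 1) * m < (\<Sum>i\<in>I. w T i)" using T by (simp add: k'_def)
    have 2: "w T i \<le> M" for i
      unfolding w_def using card_mono[of "{..<M}" "{l. l < M \<and> prod_encode (i, l) \<in> T}"] by auto
    have "has_monochromatic_edge a (w T) I k c"
      using c by (intro kneser_propertyD[OF pa I 2 k _ 1]) auto
    then show ?thesis unfolding has_monochromatic_edge_def P_def .
  qed
  define F where "F T = (SOME A. \<exists>j. P T A j)" for T
  define c' where "c' T = (SOME j. P T (F T) j)" for T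
  have PF: "P T (F T) (c' T)" if "T \<subseteq> J" "card T = k'" for T
  proof -
    have "\<exists>j. P T (F T) j" unfolding F_def by (rule someI_ex[OF ex[OF that]])
    then show ?thesis unfolding c'_def by (rule someI_ex)
  qed
  have F: "F T t \<subseteq> I \<and> card (F T t) = k \<and> c (F T t) = c' T"
    if "T \<subseteq> J" "card T = k'" "t < a" for T t using PF[OF that(1,2)] that(3) by (simp add: P_def)
  have deg: "card {t. t < a \<and> i \<in> F T t} \<le> w T i"
    if "T \<subseteq> J" "card T = k'" "i \<in> I" for T i using PF[OF that(1,2)] that(3) by (simp add: P_def)
  have "(\<Sum>x\<in>J. s' x) = (\<Sum>(i, l)\<in>I \<times> {..<M}. min L (s i - L * l))"
    unfolding J_def by (subst sum.reindex) (auto simp: s'_def intro: inj_on_subset[OF inj_prod_encode])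
  also have "\<dots> = (\<Sum>i\<in>I. \<Sum>l<M. min L (s i - L * l))" by (simp add: sum.cartesian_product)
  also have "\<dots> = (\<Sum>i\<in>I. s i)"
    unfolding sum_min_blocks using s by (intro sum.cong) (auto simp: mult.commute min_def)
  finally have total: "(\<Sum>x\<in>J. s' x) = (\<Sum>i\<in>I. s i)" .
  obtain a' b' k0 where ab: "a = Suc a'" "b = Suc b'" "k = Suc k0"
    using a b k by (metis Suc_le_D One_nat_def)
  \<comment> \<open>The two bounds compose exactly, since
    \<open>b * (a - 1) + (b - 1) = a * b - 1\<close>.\<close>
  have "b * (k' - 1) + (b - 1) * m = a * b * (k - 1) + (a * b - 1) * m"
    unfolding k'_def ab by (simp add: algebra_simps)
  then have 1: "b * (k' - 1) + (b - 1) * m < (\<Sum>x\<in>J. s' x)" using big total by simp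
  have 2: "c' T < m" if "T \<subseteq> J" "card T = k'" for T
  proof -
    have "F T 0 \<subseteq> I \<and> card (F T 0) = k \<and> c (F T 0) = c' T" using F[OF that, of 0] a by simp
    then show ?thesis using c by metis
  qed
  have 3: "s' x \<le> L" if "x \<in> J" for x using that by (auto simp: J_def s'_def)
  have "k' \<ge> 1" by (simp add: k'_def)
  then have "has_monochromatic_edge b s' J k' c'"
    by (intro kneser_propertyD[OF pb finJ 3 _ 2 1])
  then obtain T j where T: "\<And>u. u < b \<Longrightarrow> T u \<subseteq> J \<and> card (T u) = k' \<and> c' (T u) = j"
    and degT: "\<And>x. x \<in> J \<Longrightarrow> card {u. u < b \<and> x \<in> T u} \<le> s' x"
    unfolding has_monochromatic_edge_def by blast
  \<comment> \<open>Position \<open>q = u * a + v\<close> holds the \<open>v\<close>-th set of the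
    \<open>a\<close>-edge chosen for \<open>T u\<close>.\<close>
  define A where "A q = F (T (q div a)) (q mod a)" for q
  have "A q \<subseteq> I \<and> card (A q) = k \<and> c (A q) = j" if "q < a * b" for q
  proof -
    have "q div a < b" "q mod a < a" using that a by (simp_all add: div_less_iff_less_mult mult.commute)
    then show ?thesis using F T by (simp add: A_def)
  qed
  moreover have "card {q. q < a * b \<and> i \<in> A q} \<le> s i" if i: "i \<in> I" for i
  proof -
    have "card {q. q < a * b \<and> i \<in> A q} \<le> (\<Sum>u<b. card {v. v < a \<and> i \<in> F (T u) v})"
      unfolding A_def using a by (intro card_div_mod_le) simp
    also have "\<dots> \<le> (\<Sum>u<b. w (T u) i)" using deg T i by (intro sum_mono) simp
    \<comment> \<open>Incidences over \<open>i\<close> are now counted block by block, where the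
      \<open>b\<close>-edge bounds them by \<open>s'\<close>.\<close>
    also have "\<dots> = (\<Sum>l<M. card {u. u < b \<and> prod_encode (i, l) \<in> T u})"
      unfolding w_def by (rule sum_card_swap)
    also have "\<dots> \<le> (\<Sum>l<M. s' (prod_encode (i, l)))"
      using i by (intro sum_mono degT) (auto simp: J_def)
    also have "\<dots> = min (s i) (L * M)" by (simp add: s'_def sum_min_blocks)
    finally show ?thesis by simp
  qed
  ultimately show "has_monochromatic_edge (a * b) s I k c" unfolding has_monochromatic_edge_def by blast
qed

lemma kneser_property_all: "r \<ge> 2 \<Longrightarrow> kneser_property r r"
proof (induction r rule: less_induct)
  case (less r)
  then obtain p where p: "prime p" "p dvd r" using prime_factor_nat[of r] by auto
  then obtain q where q: "r = p * q" by blast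
  have p2: "p \<ge> 2" using p prime_ge_2_nat by blast
  show ?case
  proof (cases "q = 1")
    case True
    then show ?thesis using q kneser_property_prime[OF p(1)] by simp
  next
    case False
    have "q > 0" using q less.prems by (cases q) auto
    then have "q \<ge> 2" "q < r" using False q mult_less_mono1[of 1 p q] p2 by simp_all
    then have "kneser_property q q" using less.IH by blast
    then show ?thesis
      unfolding q using \<open>q \<ge> 2\<close> p2 kneser_property_prime[OF p(1)] by (intro kneser_property_mult) auto
  qed
qed

section \<open>From monochromatic edges to the chromatic number\<close>

lemma b_fun_le:
  assumes "r > 0"
  shows "b_fun r \<le> r"
proof -
  have "b_fun r \<le> (\<Prod>p\<in>prime_factors r. p ^ multiplicity p r)"
    unfolding b_fun_def by (intro prod_mono) (auto intro!: power_mono)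
  also have "\<dots> = r" using assms prod_prime_factors[of r] by simp
  finally show ?thesis .
qed

lemma chromatic_number_KG_lower_bound:
  assumes r: "r \<ge> 2" and k: "k \<ge> 1" and s: "\<forall>i\<in>{1..n}. s i < r"
  shows "(\<Sum>i=1..n. s i) \<le> r * (k - 1) + (r - 1) * chromatic_number (KG r s n k)"
proof (rule ccontr)
  define m where "m = chromatic_number (KG r s n k)"
  assume "\<not> ?thesis"
  then have big: "r * (k - 1) + (r - 1) * m < (\<Sum>i\<in>{1..n}. s i)" by (simp add: m_def)
  \<comment> \<open>Colorings exist as \<open>s i < r\<close>, so the least number of colors is
    attained.\<close>
  have "\<exists>c. is_coloring (KG r s n k) m c"
    unfolding m_def chromatic_number_def by (rule LeastI_ex, rule KG_colorable[OF k _ s]) (use r in simp)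
  then obtain c where c: "is_coloring (KG r s n k) m c" by blast
  have cm: "c A \<in> {1..m}" if "A \<subseteq> {1..n}" "card A = k" for A
    using c that by (auto simp: is_coloring_def KG_def Let_def)
  \<comment> \<open>Colors from \<open>{1..m}\<close> are moved to \<open>{..<m}\<close>; their
    positivity lets the shift be undone at the end.\<close>
  have 1: "c A - 1 < m" if "A \<subseteq> {1..n}" "card A = k" for A using cm[OF that] by auto
  have 2: "s i \<le> r" if "i \<in> {1..n}" for i using s that by (simp add: less_imp_le)
  have "has_monochromatic_edge r s {1..n} k (\<lambda>A. c A - 1)"
    by (rule kneser_propertyD[OF kneser_property_all[OF r] _ 2 k 1 big]) simp_all
  then obtain A j where A: "\<And>t. t < r \<Longrightarrow> A t \<subseteq> {1..n} \<and> card (A t) = k \<and> c (A t) - 1 = j"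
    and deg: "\<And>i. i \<in> {1..n} \<Longrightarrow> card {t. t < r \<and> i \<in> A t} \<le> s i"
    unfolding has_monochromatic_edge_def by blast
  define E where "E = image_mset A (mset_set {..<r})"
  have "size {#B \<in># E. i \<in> B#} = card {t. t < r \<and> i \<in> A t}" for i
    by (simp add: E_def filter_mset_image_mset Int_def)
  then have "E \<in> snd (KG r s n k)"
    using A deg by (auto simp: KG_def Let_def E_def)
  then have "\<not> monochromatic c E" using c by (auto simp: is_coloring_def)
  moreover have "c (A t) = Suc j" if "t < r" for t using A[OF that] cm[of "A t"] by auto
  ultimately show False by (auto simp: monochromatic_def E_def)
qed

lemma chromatic_number_KG_ceiling:
  assumes r: "r \<ge> 2" and k: "k \<ge> 1" and s: "\<forall>i\<in>{1..n}. s i \<in> {1..b_fun r - 1}"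
  shows "\<lceil>((\<Sum>i=1..n. real (s i)) - real r * (real k - 1)) / (real r - 1)\<rceil>
    \<le> int (chromatic_number (KG r s n k))"
proof -
  let ?m = "chromatic_number (KG r s n k)"
  have "\<forall>i\<in>{1..n}. s i < r"
  proof
    fix i assume "i \<in> {1..n}"
    then have "s i \<in> {1..b_fun r - 1}" using s by blast
    \<comment> \<open>Each factor of \<open>b_fun r\<close> is at most its prime, so
      \<open>b_fun r - 1\<close> lies below \<open>r\<close>.\<close>
    moreover have "b_fun r \<le> r" using b_fun_le r by simp
    ultimately show "s i < r" using r unfolding atLeastAtMost_iff by linarith
  qed
  then have "(\<Sum>i=1..n. s i) \<le> r * (k - 1) + (r - 1) * ?m"
    by (rule chromatic_number_KG_lower_bound[OF r k])
  then have "real (\<Sum>i=1..n. s i) \<le> real (r * (k - 1) + (r - 1) * ?m)" by (rule of_nat_mono)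
  also have "\<dots> = real r * (real k - 1) + (real r - 1) * real ?m" using r k by (simp add: of_nat_diff)
  finally have "(\<Sum>i=1..n. real (s i)) - real r * (real k - 1) \<le> real ?m * (real r - 1)"
    by (simp add: algebra_simps)
  then show ?thesis using r by (simp add: ceiling_le_iff divide_le_eq)
qed

theorem theorem3p7:
  fixes r k n :: nat
  assumes "r \<ge> 2" and "k \<ge> 1" and "n \<ge> 1"
  shows "(\<forall>s :: nat \<Rightarrow> nat. (\<forall>i\<in>{1..n}. s i \<in> {1..b_fun r - 1}) \<longrightarrow>
            int (chromatic_number (KG r s n k)) \<ge>
              \<lceil>((\<Sum>i=1..n. real (s i)) - real r * (real k - 1)) / (real r - 1)\<rceil>) \<and>
         (\<forall>s :: nat. s - 1 \<in> {1..b_fun r - 1} \<longrightarrow>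
            int (chromatic_number (KG r (\<lambda>_. s - 1) n k)) \<ge>
              \<lceil>((real s - 1) * real n - real r * (real k - 1)) / (real r - 1)\<rceil>)"
proof (intro conjI allI impI)
  fix s :: "nat \<Rightarrow> nat" assume "\<forall>i\<in>{1..n}. s i \<in> {1..b_fun r - 1}"
  then show "int (chromatic_number (KG r s n k)) \<ge>
      \<lceil>((\<Sum>i=1..n. real (s i)) - real r * (real k - 1)) / (real r - 1)\<rceil>"
    by (rule chromatic_number_KG_ceiling[OF assms(1,2)])
next
  fix s :: nat assume s: "s - 1 \<in> {1..b_fun r - 1}"
  then have "s \<ge> 1" unfolding atLeastAtMost_iff by linarith
  then have "real (s - 1) = real s - 1" by (simp add: of_nat_diff)
  then show "int (chromatic_number (KG r (\<lambda>_. s - 1) n k)) \<ge>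
      \<lceil>((real s - 1) * real n - real r * (real k - 1)) / (real r - 1)\<rceil>"
    using chromatic_number_KG_ceiling[OF assms(1,2), of n "\<lambda>_. s - 1"] s
    by (simp add: mult.commute)
qed

end
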